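(* Let $S\in\mathbb{R}^{d\times d}$ be symmetric positive definite, $b\in\mathbb{R}^d$, $A$ a real matrix with $d$ rows, and let $(x_n)$ be the LPSA iterates described in the context for the problem of minimizing $\frac12x^\top Sx-b^\top x$ subject to $A^\top x=0$, whose minimizer is $x^\star$. Assume that the noise covariance satisfies $\|\Sigma(x)-\Sigma(y)\|\le L\|x-y\|$ for all $x,y$ and some $L$, and that the tuple $(A,S,b)$ has degenerate order $k$ with $1\le k<\infty$, i.e. $P_{A^\perp}S^i(Sx^\star-b)=0$ for $i=0,1,\dots,k-1$ and $P_{A^\perp}S^k(Sx^\star-b)\ne0$. Let $\eta_n=\eta_0n^{-\alpha}$ and $p_n=\min\{\gamma\eta_n^\beta,1\}$ with $\gamma>0$, $0<\alpha\le1$, $0\le\beta<1$ and $\eta_0>2k\,\mathbb{1}_{\{\alpha=1\}}/\lambda_{\min}(S)$ (and $\eta_0>0$), where $\lambda_{\min}(S)$ is the smallest eigenvalue of $S$. Then, with $u_n=P_{A^\perp}x_n$ and $v_n=P_Ax_n$, as $n\to\infty$, $$\mathbb{E}\|u_n-x^\star\|^2=O\big(n^{-\alpha\min\{1,\,2k(1-\beta)\}}\big),\qquad \mathbb{E}\|P_{A^\perp}Sv_n\|^2=O\big(n^{-2k\alpha(1-\beta)}+n^{-\alpha(2-\beta)}\big).$$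
   Context: $P_A$ is the orthogonal projection of $\mathbb{R}^d$ onto the column space of $A$, and $P_{A^\perp}=I_d-P_A$ the orthogonal projection onto the null space of $A^\top$. LPSA for this problem: starting from a deterministic point $x_1$, for $n\ge1$, $$x_{n+1/2}=x_n-\eta_n(Sx_n-b)+\eta_n\xi_n,$$ and, given an independent coin $\omega_n\sim\mathrm{Bernoulli}(p_n)$, $x_{n+1}=P_{A^\perp}x_{n+1/2}$ if $\omega_n=1$ and $x_{n+1}=x_{n+1/2}$ if $\omega_n=0$. Here $\xi_n$ is stochastic gradient noise: there is an i.i.d. sequence $\zeta_n\sim\mathcal D$ (independent of the coins) and unbiased stochastic gradients $\nabla f(x,\zeta)$ of $f(x)=\frac12x^\top Sx-b^\top x$ with $\xi_n=\nabla f(x_n)-\nabla f(x_n,\zeta_n)$; so with $\mathcal F_n=\sigma(\zeta_k,\omega_k:k<n)$, $\mathbb{E}[\xi_n\mid\mathcal F_n]=0$ and $\mathbb{E}[\xi_n\xi_n^\top\mid\mathcal F_n]=\Sigma(x_n)$, where $\Sigma(x)$ is the covariance matrix of $\nabla f(x,\zeta)$. $\|\cdot\|$ is the Euclidean norm for vectors and the spectral norm for matrices. *)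

theory Defs
  imports "HOL-Probability.Probability"
begin

definition orth_proj :: "'a::euclidean_space set \<Rightarrow> 'a \<Rightarrow> 'a" where
  "orth_proj U x = (THE y. y \<in> U \<and> (\<forall>z\<in>U. orthogonal (x - y) z))"

definition proj_col :: "real^'m^'d \<Rightarrow> real^'d \<Rightarrow> real^'d" where
  "proj_col A = orth_proj (span (columns A))"

definition proj_perp :: "real^'m^'d \<Rightarrow> real^'d \<Rightarrow> real^'d" where
  "proj_perp A x = x - proj_col A x"

definition sym_pos_def :: "real^'d^'d \<Rightarrow> bool" where
  "sym_pos_def S \<longleftrightarrow> transpose S = S \<and> (\<forall>v. v \<noteq> 0 \<longrightarrow> v \<bullet> (S *v v) > 0)"

text \<open>The smallest real eigenvalue; meaningful for symmetric matrices.\<close>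

definition lambda_min :: "real^'d^'d \<Rightarrow> real" where
  "lambda_min S = (LEAST l. \<exists>v. v \<noteq> 0 \<and> S *v v = l *\<^sub>R v)"

definition spectral_norm :: "real^'m^'n \<Rightarrow> real" where
  "spectral_norm B = onorm ((*v) B)"

lemma orth_proj_eqI:
  assumes "subspace U" "y \<in> U" "\<And>z. z \<in> U \<Longrightarrow> orthogonal (x - y) z"
  shows "orth_proj U x = y"
  unfolding orth_proj_def
proof (rule the_equality)
  show "y \<in> U \<and> (\<forall>z\<in>U. orthogonal (x - y) z)"
    using assms by blast
next
  fix y' assume y': "y' \<in> U \<and> (\<forall>z\<in>U. orthogonal (x - y') z)"
  then have "y' - y \<in> U"
    using assms by (simp add: subspace_diff)
  then have "(x - y) \<bullet> (y' - y) = 0" "(x - y') \<bullet> (y' - y) = 0"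
    using assms(3) y' by (auto simp: orthogonal_def)
  then have "(y' - y) \<bullet> (y' - y) = 0"
    by (simp add: inner_diff_left)
  then show "y' = y" by simp
qed

lemma
  assumes "subspace U"
  shows orth_proj_in: "orth_proj U x \<in> U"
    and orth_proj_orthogonal: "z \<in> U \<Longrightarrow> orthogonal (x - orth_proj U x) z"
proof -
  obtain y w where y: "y \<in> span U" and w: "\<And>z. z \<in> span U \<Longrightarrow> orthogonal w z" and x: "x = y + w"
    using orthogonal_subspace_decomp_exists[of U x] by metis
  have U: "span U = U" using assms by (simp add: span_eq_iff)
  have "orth_proj U x = y"
    using y w U x by (intro orth_proj_eqI assms) auto
  then show "orth_proj U x \<in> U" and "z \<in> U \<Longrightarrow> orthogonal (x - orth_proj U x) z"
    using y w U x by auto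
qed

lemma proj_perp_eq_orth_proj_null_space:
  "proj_perp A x = orth_proj {y. transpose A *v y = 0} x"
proof (rule sym, rule orth_proj_eqI)
  show "subspace {y. transpose A *v y = 0}"
    by (auto simp: subspace_def matrix_vector_right_distrib matrix_vector_mult_scaleR
        simp del: transpose_matrix_vector)
next
  have "(transpose A *v (x - proj_col A x)) \<bullet> z = 0" for z
  proof -
    have "A *v z \<in> span (columns A)"
      by (rule matrix_vector_mult_in_columnspace)
    then have "(x - proj_col A x) \<bullet> (A *v z) = 0"
      unfolding proj_col_def using orth_proj_orthogonal[OF subspace_span] by (auto simp: orthogonal_def)
    then show ?thesis
      by (simp add: dot_lmul_matrix)
  qed
  then show "proj_perp A x \<in> {y. transpose A *v y = 0}"
    unfolding proj_perp_def using inner_eq_zero_iff[of "transpose A *v (x - proj_col A x)"]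
    by (simp del: transpose_matrix_vector)
next
  fix z assume "z \<in> {y. transpose A *v y = 0}"
  then have z: "transpose A *v z = 0" by simp
  have "orthogonal z c" if "c \<in> columns A" for c
  proof -
    from that obtain i where c: "c = column i A" by (auto simp: columns_def)
    have "(transpose A *v z) $ i = z \<bullet> c"
      by (simp add: matrix_vector_mult_def transpose_def c column_def inner_vec_def mult.commute)
    then show ?thesis using z by (simp add: orthogonal_def)
  qed
  then have "orthogonal z (proj_col A x)"
    unfolding proj_col_def
    by (intro orthogonal_to_span[OF orth_proj_in[OF subspace_span]]) auto
  then show "orthogonal (x - proj_perp A x) z"
    by (simp add: proj_perp_def orthogonal_commute)
qed

definition quad_obj :: "real^'d^'d \<Rightarrow> real^'d \<Rightarrow> real^'d \<Rightarrow> real" where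
  "quad_obj S b x = 1/2 * (x \<bullet> (S *v x)) - b \<bullet> x"

definition quad_grad :: "real^'d^'d \<Rightarrow> real^'d \<Rightarrow> real^'d \<Rightarrow> real^'d" where
  "quad_grad S b x = S *v x - b"

lemma quad_grad_is_gradient:
  assumes "transpose S = S"
  shows "(quad_obj S b has_derivative (\<lambda>h. quad_grad S b x \<bullet> h)) (at x)"
proof -
  have sym: "x \<bullet> (S *v h) = (S *v x) \<bullet> h" for h
    using dot_lmul_matrix[of x S h] transpose_matrix_vector[of S x] assms by simp
  have lin: "((*v) S has_derivative (*v) S) (at x)"
    by (rule bounded_linear_imp_has_derivative[OF matrix_vector_mul_bounded_linear])
  have "((\<lambda>x. 1/2 * (x \<bullet> (S *v x)) - b \<bullet> x) has_derivative
      (\<lambda>h. 1/2 * (x \<bullet> (S *v h) + h \<bullet> (S *v x)) - b \<bullet> h)) (at x)"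
    by (intro has_derivative_diff has_derivative_mult_right has_derivative_inner lin
        has_derivative_ident has_derivative_inner_right)
  moreover have "1/2 * (x \<bullet> (S *v h) + h \<bullet> (S *v x)) - b \<bullet> h = quad_grad S b x \<bullet> h" for h
    unfolding quad_grad_def sym inner_diff_left inner_commute[of h] by simp
  ultimately show ?thesis
    unfolding quad_obj_def[abs_def] by simp
qed

text \<open>The power of \<open>S\<close> is written as an iterate of the linear map: \<open>S ^ i\<close> on \<open>real^'d^'d\<close>
  would be the entrywise power.\<close>

definition has_degenerate_order ::
    "real^'m^'d \<Rightarrow> real^'d^'d \<Rightarrow> real^'d \<Rightarrow> real^'d \<Rightarrow> nat \<Rightarrow> bool" where
  "has_degenerate_order A S b xstar k \<longleftrightarrow>
     (\<forall>i<k. proj_perp A (((*v) S ^^ i) (S *v xstar - b)) = 0) \<and>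
     proj_perp A (((*v) S ^^ k) (S *v xstar - b)) \<noteq> 0"

definition cov_matrix :: "'z measure \<Rightarrow> ('z \<Rightarrow> real^'d) \<Rightarrow> real^'d^'d" where
  "cov_matrix D X =
     (\<chi> i j. LINT z|D. (X z $ i - (LINT y|D. X y $ i)) * (X z $ j - (LINT y|D. X y $ j)))"

text \<open>Mutual independence of all the random elements \<open>\<zeta> n\<close>, \<open>\<omega> n\<close> with \<open>n \<ge> 1\<close>. It is phrased via the
  generated \<open>\<sigma>\<close>-algebras because \<open>prob_space.indep_vars\<close> needs one common value type. It presupposes
  that the \<open>\<zeta> n\<close> and \<open>\<omega> n\<close> are measurable.\<close>

definition samples_coins_independent ::
    "'w measure \<Rightarrow> 'z measure \<Rightarrow> (nat \<Rightarrow> 'w \<Rightarrow> 'z) \<Rightarrow> (nat \<Rightarrow> 'w \<Rightarrow> bool) \<Rightarrow> bool" where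
  "samples_coins_independent M D \<zeta> \<omega> \<longleftrightarrow>
     prob_space.indep_sets M
       (case_sum (\<lambda>n. sets (vimage_algebra (space M) (\<zeta> n) D))
                 (\<lambda>n. sets (vimage_algebra (space M) (\<omega> n) (count_space UNIV))))
       ({1..} <+> {1..})"

end

theory Submission
  imports Defs
begin

text \<open>
  Write \<open>Q\<close> for the projection onto the null space of the transpose of \<open>A\<close>, \<open>P = I - Q\<close>, and
  \<open>c = S x\<^sup>* - b\<close> for the gradient at the minimiser. Between two projections the error \<open>x\<^sub>n - x\<^sup>*\<close> is
  pushed by the constant force \<open>- \<eta>\<^sub>n c\<close>, so after a time \<open>\<tau>\<close> (the sum of the step sizes since the last
  projection) it has moved by about \<open>- \<tau> c + \<tau>\<^sup>2/2 S c - \<dots>\<close>. A projection occurs with probability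
  \<open>p\<^sub>n\<close>, hence \<open>\<tau>\<close> is of order \<open>\<eta>\<^sub>n / p\<^sub>n\<close>, that is, of order \<open>n\<close> to the power \<open>- \<alpha> (1 - \<beta>)\<close>.
  Degenerate order \<open>k\<close> says that the first \<open>k\<close> Krylov vectors \<open>S\<^sup>i c\<close> are normal to the constraint, so \<open>Q\<close> does
  not see this motion itself below the order \<open>\<tau>\<^sup>k\<^sup>+\<^sup>1\<close>, nor its image under \<open>S\<close> below the order \<open>\<tau>\<^sup>k\<close>.

  To make this exact, the part of the motion along the first \<open>k\<close> Krylov vectors is subtracted. Its random
  coefficients (\<open>coef\<close>) depend on the coins only: they obey a triangular linear recursion and are reset to \<open>0\<close>
  by every projection. This \<open>excursion\<close> lies in the kernel of \<open>Q\<close>, so the remaining \<open>residual\<close>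
  satisfies (lemma \<open>residual_Suc\<close>) the plain gradient iteration, followed by \<open>Q\<close> or the identity, with
  constant force \<open>c\<close> replaced by the much smaller \<open>a\<^sub>k S\<^sup>k c\<close>, where \<open>a\<^sub>k\<close> is the last coefficient. Both
  quantities of interest can be read off: \<open>Q x\<^sub>n - x\<^sup>*\<close> is \<open>Q\<close> applied to the residual, and
  \<open>Q S P x\<^sub>n\<close> is \<open>Q S P\<close> applied to the residual, plus \<open>a\<^sub>k Q S\<^sup>k c\<close>.

  It remains to bound three families of second moments, all through one scalar comparison lemma
  (\<open>contraction_recursion_bigo\<close>).

  \<^item> The coefficients are killed at rate \<open>p\<^sub>n\<close> and fed by \<open>\<eta>\<^sub>n\<close> times the previous coefficient, so
    the second moment of the \<open>j\<close>-th one is at most of order \<open>(\<eta>\<^sub>n / p\<^sub>n)\<^sup>2\<^sup>j\<close> (\<open>coef_rate\<close>).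

  \<^item> The residual contracts at rate \<open>\<eta>\<^sub>n\<close> times the least eigenvalue, because projecting does not increase
    norms. It is forced by \<open>\<eta>\<^sub>n a\<^sub>k\<close> and by noise of variance of order \<open>\<eta>\<^sub>n\<^sup>2\<close>, so its second moment is at most of
    order \<open>(\<eta>\<^sub>n / p\<^sub>n)\<^sup>2\<^sup>k + \<eta>\<^sub>n\<close> (\<open>residual_rate\<close>). This is the first claim.

  \<^item> The normal part of the residual is in addition killed at rate \<open>p\<^sub>n\<close>. The forcing by the residual itself is
    damped by the factor \<open>\<eta>\<^sub>n / p\<^sub>n\<close>, and the noise accumulates only over \<open>1 / p\<^sub>n\<close> steps, so the bound improves to
    \<open>(\<eta>\<^sub>n / p\<^sub>n)\<^sup>2\<^sup>k + \<eta>\<^sub>n\<^sup>2 / p\<^sub>n\<close> (\<open>normal_rate\<close>). This is the second claim.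
\<close>

section \<open>Scalar recursions with polynomially decaying rates\<close>

lemma powr_neg_Suc_ge:
  fixes \<theta> :: real
  assumes "n \<ge> 1" "0 \<le> \<theta>"
  shows "real n powr (-\<theta>) * (1 - \<theta> / real n) \<le> real (Suc n) powr (-\<theta>)"
proof -
  have pos: "0 < 1 + 1 / real n"
    by (simp add: add_pos_nonneg)
  have "1 - \<theta> / real n \<le> 1 + (- \<theta> * ln (1 + 1 / real n))"
    using mult_left_mono[OF ln_add_one_self_le_self[of "1 / real n"] assms(2)] by simp
  also have "\<dots> \<le> exp (- \<theta> * ln (1 + 1 / real n))"
    by (rule exp_ge_add_one_self)
  also have "\<dots> = (1 + 1 / real n) powr (-\<theta>)"
    using pos by (simp add: powr_def)
  finally have "real n powr (-\<theta>) * (1 - \<theta> / real n) \<le> real n powr (-\<theta>) * (1 + 1 / real n) powr (-\<theta>)"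
    by (intro mult_left_mono) auto
  also have "\<dots> = (real n * (1 + 1 / real n)) powr (-\<theta>)"
    by (simp add: powr_mult)
  also have "real n * (1 + 1 / real n) = real (Suc n)"
    using assms by (simp add: field_simps)
  finally show ?thesis .
qed

text \<open>The comparison principle behind all rates: a contraction by \<open>c n\<^sup>-\<^sup>a\<close> per step divides the forcing by
  \<open>n\<^sup>-\<^sup>a\<close>. For \<open>a < 1\<close> every polynomial rate is attainable; at \<open>a = 1\<close> the homogeneous recursion itself
  decays only like \<open>n\<^sup>-\<^sup>c\<close>, whence the condition \<open>\<theta> < c\<close>.\<close>
lemma contraction_recursion_bigo:
  fixes X f :: "nat \<Rightarrow> real"
  assumes nonneg: "\<And>n. n \<ge> 1 \<Longrightarrow> 0 \<le> X n"
    and c: "0 < c" and a: "a \<le> 1" and \<theta>: "0 \<le> \<theta>" and crit: "a = 1 \<Longrightarrow> \<theta> < c"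
    and small: "\<forall>\<^sub>F n in sequentially. c * real n powr (-a) \<le> 1"
    and step: "\<forall>\<^sub>F n in sequentially. X (Suc n) \<le> (1 - c * real n powr (-a)) * X n + f n"
    and f: "f \<in> O(\<lambda>n. real n powr (-(a + \<theta>)))"
  shows "X \<in> O(\<lambda>n. real n powr (-\<theta>))"
proof -
  \<comment> \<open>A bound \<open>K n\<^sup>-\<^sup>\<theta>\<close> loses the relative amount \<open>\<theta> / n\<close> per step, while the recursion gains
    \<open>c n\<^sup>-\<^sup>a\<close>; the surplus is at least \<open>\<delta> n\<^sup>-\<^sup>a\<close>.\<close>
  obtain \<delta> where \<delta>: "\<delta> > 0" and slack: "\<forall>\<^sub>F n in sequentially. \<delta> + \<theta> * real n powr (a - 1) \<le> c"
  proof (cases "a = 1")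
    case True
    have "\<forall>\<^sub>F n in sequentially. (c - \<theta>) + \<theta> * real n powr (a - 1) \<le> c"
      using eventually_gt_at_top[of 0] by eventually_elim (auto simp: True)
    then show ?thesis using crit True that[of "c - \<theta>"] by simp
  next
    case False
    then have "(\<lambda>n. \<theta> * real n powr (a - 1)) \<longlonglongrightarrow> \<theta> * 0"
      using a by (intro tendsto_mult tendsto_const tendsto_neg_powr filterlim_real_sequentially) auto
    then have "\<forall>\<^sub>F n in sequentially. \<theta> * real n powr (a - 1) < c / 2"
      using c by (intro order_tendstoD) auto
    then have "\<forall>\<^sub>F n in sequentially. c / 2 + \<theta> * real n powr (a - 1) \<le> c"
      by eventually_elim auto
    then show ?thesis using c that[of "c / 2"] by simp
  qed
  obtain B where B: "B > 0"
    and fB: "\<forall>\<^sub>F n in sequentially. norm (f n) \<le> B * norm (real n powr (-(a + \<theta>)))"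
    using f by (elim landau_o.bigE)
  have "\<forall>\<^sub>F n in sequentially. n \<ge> 1 \<and> c * real n powr (-a) \<le> 1 \<and>
      X (Suc n) \<le> (1 - c * real n powr (-a)) * X n + f n \<and>
      \<delta> + \<theta> * real n powr (a - 1) \<le> c \<and> norm (f n) \<le> B * norm (real n powr (-(a + \<theta>)))"
    using small step slack fB by (intro eventually_conj eventually_ge_at_top)
  then obtain N where N: "\<And>n. n \<ge> N \<Longrightarrow> n \<ge> 1 \<and> c * real n powr (-a) \<le> 1 \<and>
      X (Suc n) \<le> (1 - c * real n powr (-a)) * X n + f n \<and>
      \<delta> + \<theta> * real n powr (a - 1) \<le> c \<and> norm (f n) \<le> B * norm (real n powr (-(a + \<theta>)))"
    unfolding eventually_sequentially by blast
  \<comment> \<open>The surplus has to pay for the forcing, and the bound has to hold at the start \<open>N\<close>.\<close>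
  define K where "K = max (B / \<delta>) (X N * real N powr \<theta>)"
  have K0: "0 \<le> K" using B \<delta> by (simp add: K_def le_max_iff_disj)
  have KB: "B \<le> K * \<delta>"
    using \<delta> by (simp add: K_def max_def field_simps)
  have bound: "X n \<le> K * real n powr (-\<theta>)" if "n \<ge> N" for n
    using that
  proof (induction n rule: dec_induct)
    case base
    have "X N = X N * real N powr \<theta> * real N powr (-\<theta>)"
      using N[of N] by (simp add: powr_minus)
    also have "\<dots> \<le> K * real N powr (-\<theta>)"
      by (intro mult_right_mono) (auto simp: K_def)
    finally show ?case .
  next
    case (step n)
    then have n: "n \<ge> 1" and n': "n \<ge> N" using N[of N] by auto
    note Nn = N[OF n']
    define t where "t = real n powr (-a)"
    have t: "0 < t" using n by (simp add: t_def)
    have fn: "f n \<le> B * t * real n powr (-\<theta>)"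
      using Nn by (simp add: t_def powr_add[symmetric] mult.assoc abs_le_iff)
    have ta: "\<theta> / real n = \<theta> * real n powr (a - 1) * t"
    proof -
      have "real n powr (a - 1) * t = 1 / real n"
        using n unfolding t_def powr_add[symmetric] by (simp add: powr_minus_divide)
      then show ?thesis by (simp add: mult.assoc)
    qed
    have "K * (1 - c * t) + B * t \<le> K * (1 - c * t) + K * \<delta> * t"
      using KB t by (intro add_left_mono mult_right_mono) auto
    also have "\<dots> = K * (1 - (c - \<delta>) * t)"
      by (simp add: algebra_simps)
    also have "\<dots> \<le> K * (1 - \<theta> * real n powr (a - 1) * t)"
      using Nn K0 t by (intro mult_left_mono diff_left_mono mult_right_mono) auto
    finally have key: "K * (1 - c * t) + B * t \<le> K * (1 - \<theta> / real n)"
      by (simp add: ta)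
    have "X (Suc n) \<le> (1 - c * t) * X n + f n"
      using Nn by (simp add: t_def)
    also have "\<dots> \<le> (1 - c * t) * (K * real n powr (-\<theta>)) + B * t * real n powr (-\<theta>)"
      using Nn by (intro add_mono mult_left_mono step.IH fn) (auto simp: t_def)
    also have "\<dots> = (K * (1 - c * t) + B * t) * real n powr (-\<theta>)"
      by (simp add: algebra_simps)
    also have "\<dots> \<le> K * (1 - \<theta> / real n) * real n powr (-\<theta>)"
      by (intro mult_right_mono key) auto
    also have "\<dots> \<le> K * real (Suc n) powr (-\<theta>)"
      using mult_left_mono[OF powr_neg_Suc_ge[OF n \<theta>] K0] by (simp add: mult_ac)
    finally show ?case .
  qed
  show ?thesis
  proof (rule bigoI[where c = K])
    show "\<forall>\<^sub>F n in sequentially. norm (X n) \<le> K * norm (real n powr (-\<theta>))"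
      using eventually_ge_at_top[of N] by eventually_elim (use N nonneg bound in force)
  qed
qed

lemma powr_bigo_powr:
  assumes "a \<le> b"
  shows "(\<lambda>n. real n powr a) \<in> O(\<lambda>n. real n powr b)"
proof (rule bigoI[where c = 1])
  show "\<forall>\<^sub>F n in sequentially. norm (real n powr a) \<le> 1 * norm (real n powr b)"
    using eventually_ge_at_top[of 1] by eventually_elim (use assms in \<open>simp add: powr_mono\<close>)
qed

lemma bigo_powr_mult:
  fixes f f' :: "nat \<Rightarrow> real"
  assumes "f \<in> O(\<lambda>n. real n powr a)" "f' \<in> O(\<lambda>n. real n powr b)" "a + b \<le> c"
  shows "(\<lambda>n. f n * f' n) \<in> O(\<lambda>n. real n powr c)"
  using landau_o.big.mult[OF assms(1,2)] landau_o.big_trans[OF _ powr_bigo_powr[OF assms(3)]]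
  by (simp add: powr_add)

lemma bigo_powr_mono:
  fixes f :: "nat \<Rightarrow> real"
  assumes "f \<in> O(\<lambda>n. real n powr a)" "a \<le> b"
  shows "f \<in> O(\<lambda>n. real n powr b)"
  by (rule landau_o.big_trans[OF assms(1) powr_bigo_powr[OF assms(2)]])

lemma bigo_of_nonneg_le:
  fixes f f' :: "nat \<Rightarrow> real"
  assumes "\<And>n. n \<ge> 1 \<Longrightarrow> 0 \<le> f n" "\<And>n. n \<ge> 1 \<Longrightarrow> f n \<le> f' n" "f' \<in> O(r)"
  shows "f \<in> O(r)"
proof (rule landau_o.big_trans[OF _ assms(3)])
  show "f \<in> O(f')"
  proof (rule bigoI[where c = 1])
    show "\<forall>\<^sub>F n in sequentially. norm (f n) \<le> 1 * norm (f' n)"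
      using eventually_ge_at_top[of 1] by eventually_elim (use assms(1,2) in force)
  qed
qed

lemma bounded_of_bigo_powr:
  fixes f :: "nat \<Rightarrow> real"
  assumes "f \<in> O(\<lambda>n. real n powr (- a))" "0 \<le> a"
  shows "f \<in> O(\<lambda>n. real n powr 0)"
  using bigo_powr_mono[OF assms(1), of 0] assms(2) by simp

lemma const_bigo_1: "(\<lambda>n. a :: real) \<in> O(\<lambda>n. real n powr 0)"
proof (rule bigoI[where c = "\<bar>a\<bar>"])
  show "\<forall>\<^sub>F n in sequentially. norm a \<le> \<bar>a\<bar> * norm (real n powr 0)"
    using eventually_ge_at_top[of 1] by eventually_elim auto
qed

section \<open>Linear algebra\<close>

lemma norm_diff_sq_le_weighted:
  fixes v h :: "'a::real_inner"
  assumes "0 < \<epsilon>"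
  shows "(norm (v - h))\<^sup>2 \<le> (1 + \<epsilon>) * (norm v)\<^sup>2 + (1 + 1 / \<epsilon>) * (norm h)\<^sup>2"
proof -
  have "0 \<le> (norm (\<epsilon> *\<^sub>R v + h))\<^sup>2 / \<epsilon>"
    using assms by simp
  also have "\<dots> = \<epsilon> * (norm v)\<^sup>2 + 2 * (v \<bullet> h) + (norm h)\<^sup>2 / \<epsilon>"
  proof -
    have "(norm (\<epsilon> *\<^sub>R v + h))\<^sup>2 = \<epsilon> * (\<epsilon> * (norm v)\<^sup>2 + 2 * (v \<bullet> h)) + (norm h)\<^sup>2"
      unfolding power2_norm_eq_inner
      by (simp add: inner_add_left inner_add_right inner_commute[of h v] algebra_simps)
    then show ?thesis using assms by (simp add: add_divide_distrib)
  qed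
  finally show ?thesis
    by (simp add: power2_norm_eq_inner inner_diff_left inner_diff_right inner_commute[of h v] algebra_simps)
qed

text \<open>A vector that is set to \<open>0\<close> with probability \<open>q\<close> can afford a perturbation \<open>h\<close>: Young's inequality with
  weight \<open>q / 2\<close> spends half of the contraction on the cross term.\<close>
lemma survival_norm_diff_sq_le:
  fixes v h :: "'a::real_inner"
  assumes "0 < q" "q \<le> 1"
  shows "(1 - q) * (norm (v - h))\<^sup>2 \<le> (1 - q / 2) * (norm v)\<^sup>2 + 2 / q * (norm h)\<^sup>2"
proof -
  have "(1 - q) * (norm (v - h))\<^sup>2 \<le> (1 - q) * ((1 + q / 2) * (norm v)\<^sup>2 + (1 + 1 / (q / 2)) * (norm h)\<^sup>2)"
    using assms by (intro mult_left_mono norm_diff_sq_le_weighted) auto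
  also have "\<dots> = (1 - q / 2 - q\<^sup>2 / 2) * (norm v)\<^sup>2 + (2 / q - (1 + q)) * (norm h)\<^sup>2"
    using assms by (simp add: field_simps power2_eq_square)
  also have "\<dots> \<le> (1 - q / 2) * (norm v)\<^sup>2 + 2 / q * (norm h)\<^sup>2"
    using assms by (intro add_mono mult_right_mono) auto
  finally show ?thesis .
qed

lemma norm_add_sq_le:
  fixes v h :: "'a::real_inner"
  shows "(norm (v + h))\<^sup>2 \<le> 2 * (norm v)\<^sup>2 + 2 * (norm h)\<^sup>2"
  using norm_diff_sq_le_weighted[where \<epsilon> = 1 and v = v and h = "-h"] by simp

text \<open>The minimum of the Rayleigh quotient over the compact unit sphere is attained, and a minimiser is an
  eigenvector. So the least eigenvalue exists and is the coercivity constant of \<open>S\<close>.\<close>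
lemma lambda_min_rayleigh:
  fixes S :: "real^'d^'d"
  assumes S: "sym_pos_def S"
  shows "0 < lambda_min S" and "lambda_min S * (norm v)\<^sup>2 \<le> v \<bullet> (S *v v)"
proof -
  have sym: "x \<bullet> (S *v h) = (S *v x) \<bullet> h" for x h
    using S dot_lmul_matrix[of x S h] transpose_matrix_vector[of S x] by (simp add: sym_pos_def_def)
  have "continuous_on (sphere 0 1) (\<lambda>v. v \<bullet> (S *v v))"
    by (intro continuous_intros linear_continuous_on matrix_vector_mul_bounded_linear)
  moreover have "axis undefined 1 \<in> sphere (0::real^'d) 1" by simp
  ultimately obtain w where w: "w \<in> sphere 0 1"
    and min: "\<And>y. y \<in> sphere 0 1 \<Longrightarrow> w \<bullet> (S *v w) \<le> y \<bullet> (S *v y)"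
    using continuous_attains_inf[of "sphere (0::real^'d) 1" "\<lambda>v. v \<bullet> (S *v v)"] by fastforce
  define \<mu> where "\<mu> = w \<bullet> (S *v w)"
  have nw: "norm w = 1" using w by simp
  have ray: "\<mu> * (norm y)\<^sup>2 \<le> y \<bullet> (S *v y)" for y
  proof (cases "y = 0")
    case False
    then have "\<mu> \<le> sgn y \<bullet> (S *v sgn y)"
      unfolding \<mu>_def by (intro min) (simp add: norm_sgn)
    also have "\<dots> = (y \<bullet> (S *v y)) / (norm y)\<^sup>2"
      by (simp add: sgn_div_norm matrix_vector_mult_scaleR power2_eq_square divide_inverse)
    finally show ?thesis using False by (simp add: field_simps)
  qed simp
  \<comment> \<open>First-order optimality: moving the minimiser \<open>w\<close> by \<open>- t r\<close> along its defect \<open>r\<close> would decrease the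
    form \<open>y \<bullet> S y - \<mu> |y|\<^sup>2 \<ge> 0\<close>, which vanishes at \<open>w\<close>, to first order in \<open>t\<close>.\<close>
  have eig: "S *v w = \<mu> *\<^sub>R w"
  proof -
    define r where "r = S *v w - \<mu> *\<^sub>R w"
    have wr: "w \<bullet> r = 0"
      using nw by (simp add: r_def inner_diff_right \<mu>_def power2_norm_eq_inner[symmetric])
    define \<rho> where "\<rho> = r \<bullet> (S *v r) - \<mu> * (norm r)\<^sup>2"
    have \<rho>: "0 \<le> \<rho>" using ray[of r] by (simp add: \<rho>_def)
    have ineq: "2 * t * (norm r)\<^sup>2 \<le> t\<^sup>2 * \<rho>" for t
    proof -
      have "0 \<le> (w - t *\<^sub>R r) \<bullet> (S *v (w - t *\<^sub>R r)) - \<mu> * (norm (w - t *\<^sub>R r))\<^sup>2"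
        using ray[of "w - t *\<^sub>R r"] by simp
      also have "(norm (w - t *\<^sub>R r))\<^sup>2 = 1 + t\<^sup>2 * (norm r)\<^sup>2"
        using nw wr unfolding power2_norm_eq_inner
        by (simp add: inner_diff_left inner_diff_right inner_commute[of r w] power2_eq_square norm_eq_1)
      also have "(w - t *\<^sub>R r) \<bullet> (S *v (w - t *\<^sub>R r)) = \<mu> - 2 * t * (r \<bullet> (S *v w)) + t\<^sup>2 * (r \<bullet> (S *v r))"
        using sym[of w r] by (simp add: matrix_vector_mult_diff_distrib matrix_vector_mult_scaleR inner_diff_left
            inner_diff_right \<mu>_def power2_eq_square inner_commute[of "S *v w" r] algebra_simps)
      also have "r \<bullet> (S *v w) = (norm r)\<^sup>2"
      proof -
        have "S *v w = r + \<mu> *\<^sub>R w" by (simp add: r_def)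
        then show ?thesis using wr by (simp add: inner_add_right power2_norm_eq_inner inner_commute)
      qed
      finally show ?thesis by (simp add: \<rho>_def algebra_simps)
    qed
    have "r = 0"
    proof (rule ccontr)
      assume "r \<noteq> 0"
      then have n: "0 < (norm r)\<^sup>2" by simp
      define t where "t = (norm r)\<^sup>2 / (\<rho> + 1)"
      have t: "0 < t" using n \<rho> by (simp add: t_def)
      then have "2 * (norm r)\<^sup>2 \<le> t * \<rho>"
        using ineq[of t] by (simp add: power2_eq_square)
      also have "\<dots> \<le> (norm r)\<^sup>2"
        using \<rho> n by (simp add: t_def field_simps)
      finally show False using n by simp
    qed
    then show ?thesis by (simp add: r_def)
  qed
  have "lambda_min S = \<mu>"
    unfolding lambda_min_def
  proof (rule Least_equality)
    show "\<exists>v. v \<noteq> 0 \<and> S *v v = \<mu> *\<^sub>R v" using eig nw by (intro exI[of _ w]) auto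
  next
    fix l assume "\<exists>v. v \<noteq> 0 \<and> S *v v = l *\<^sub>R v"
    then obtain v where v: "v \<noteq> 0" "S *v v = l *\<^sub>R v" by blast
    then show "\<mu> \<le> l"
      using ray[of v] by (simp add: power2_norm_eq_inner)
  qed
  moreover have "0 < \<mu>"
    using S nw unfolding sym_pos_def_def \<mu>_def by (metis norm_zero zero_neq_one)
  ultimately show "0 < lambda_min S" "lambda_min S * (norm v)\<^sup>2 \<le> v \<bullet> (S *v v)"
    using ray by auto
qed

lemma proj_perp_props:
  fixes A :: "real^'m^'d"
  shows "linear (proj_perp A)" "proj_perp A (proj_perp A v) = proj_perp A v"
    "norm (proj_perp A v) \<le> norm v" "norm (v - proj_perp A v) \<le> norm v"
proof -
  let ?U = "span (columns A)"
  have U: "subspace ?U" by (rule subspace_span)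
  note P = orth_proj_in[OF U] orth_proj_orthogonal[OF U]
  have eq: "orth_proj ?U x = y" if "y \<in> ?U" "\<And>z. z \<in> ?U \<Longrightarrow> orthogonal (x - y) z" for x y
    using that by (rule orth_proj_eqI[OF U])
  have lin: "linear (orth_proj ?U)"
  proof (rule linearI)
    fix x y r
    show "orth_proj ?U (x + y) = orth_proj ?U x + orth_proj ?U y"
      using P(2)[of _ x] P(2)[of _ y]
      by (intro eq span_add P) (simp_all add: orthogonal_def algebra_simps inner_simps)
    show "orth_proj ?U (r *\<^sub>R x) = r *\<^sub>R orth_proj ?U x"
      using P(2)[of _ x]
      by (intro eq span_scale P) (simp_all add: orthogonal_def inner_diff_left)
  qed
  then show "linear (proj_perp A)"
    unfolding proj_perp_def[abs_def] proj_col_def by (intro linear_compose_sub linear_ident)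
  have idem: "orth_proj ?U (orth_proj ?U v) = orth_proj ?U v"
    by (intro eq P) (simp add: orthogonal_def)
  then show "proj_perp A (proj_perp A v) = proj_perp A v"
    using lin by (simp add: proj_perp_def proj_col_def linear_diff)
  have "(norm v)\<^sup>2 = (norm (v - orth_proj ?U v))\<^sup>2 + (norm (orth_proj ?U v))\<^sup>2"
    using norm_add_Pythagorean[OF P(2)[OF P(1)], of v v] by simp
  then show "norm (proj_perp A v) \<le> norm v" "norm (v - proj_perp A v) \<le> norm v"
    by (simp_all add: proj_perp_def proj_col_def power2_le_iff_abs_le[symmetric] power_mono_iff[symmetric, of _ _ 2])
qed

lemma diag_entry_le_spectral_norm:
  fixes B :: "real^'d^'d"
  shows "B $ i $ i \<le> spectral_norm B"
proof -
  have "B $ i $ i = (B *v axis i 1) $ i"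
    by (simp add: matrix_vector_mul_component inner_axis)
  also have "\<dots> \<le> norm (B *v axis i 1)"
    using component_le_norm_cart[of "B *v axis i 1" i] by simp
  also have "\<dots> \<le> onorm ((*v) B) * norm (axis i 1 :: real^'d)"
    by (rule onorm[OF matrix_vector_mul_bounded_linear])
  finally show ?thesis by (simp add: spectral_norm_def)
qed

section \<open>Integration against fresh randomness\<close>

lemma integrable_norm_sq_add:
  fixes X Y :: "'a \<Rightarrow> 'v::euclidean_space"
  assumes [measurable]: "X \<in> borel_measurable M" "Y \<in> borel_measurable M"
    and int: "integrable M (\<lambda>w. (norm (X w))\<^sup>2)" "integrable M (\<lambda>w. (norm (Y w))\<^sup>2)"
  shows "integrable M (\<lambda>w. (norm (X w + Y w))\<^sup>2)"
proof (rule Bochner_Integration.integrable_bound)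
  show "integrable M (\<lambda>w. 2 * (norm (X w))\<^sup>2 + 2 * (norm (Y w))\<^sup>2)" using int by simp
qed (use norm_add_sq_le in \<open>auto intro!: AE_I2\<close>)

lemma integrable_norm_sq_linear:
  fixes X :: "'a \<Rightarrow> 'v::euclidean_space" and T :: "'v \<Rightarrow> 'u::euclidean_space"
  assumes [measurable]: "X \<in> borel_measurable M" and T: "linear T"
    and int: "integrable M (\<lambda>w. (norm (X w))\<^sup>2)"
  shows "integrable M (\<lambda>w. (norm (T (X w)))\<^sup>2)"
proof (rule Bochner_Integration.integrable_bound)
  have bl: "bounded_linear T" using T by (simp add: linear_conv_bounded_linear)
  have [measurable]: "T \<in> borel_measurable borel"
    using bl by (intro borel_measurable_continuous_onI linear_continuous_on)
  show "integrable M (\<lambda>w. (onorm T)\<^sup>2 * (norm (X w))\<^sup>2)" using int by simp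
  show "AE w in M. norm ((norm (T (X w)))\<^sup>2) \<le> norm ((onorm T)\<^sup>2 * (norm (X w))\<^sup>2)"
    using power_mono[OF onorm[OF bl], where n = 2] by (auto simp: power_mult_distrib)
  show "(\<lambda>w. (norm (T (X w)))\<^sup>2) \<in> borel_measurable M" by measurable
qed

lemma variance_eq_trace_cov_matrix:
  fixes X :: "'z \<Rightarrow> real^'d"
  assumes "prob_space D" and X: "X \<in> borel_measurable D" "integrable D (\<lambda>z. (norm (X z))\<^sup>2)"
  shows "integrable D X" "integrable D (\<lambda>z. (norm (X z - (LINT y|D. X y)))\<^sup>2)"
    "(LINT z|D. (norm (X z - (LINT y|D. X y)))\<^sup>2) = (\<Sum>i\<in>UNIV. cov_matrix D X $ i $ i)"
proof -
  interpret prob_space D by fact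
  show int: "integrable D X"
  proof (rule Bochner_Integration.integrable_bound)
    show "integrable D (\<lambda>z. 1 + (norm (X z))\<^sup>2)" using X by simp
    have "t \<le> 1 + t\<^sup>2" if "t \<ge> 0" for t :: real
      using zero_le_power2[of "t - 1"] that by (simp add: power2_diff)
    then show "AE z in D. norm (X z) \<le> norm (1 + (norm (X z))\<^sup>2)" by simp
  qed (use X in auto)
  define m where "m = (LINT y|D. X y)"
  have mi: "(LINT y|D. X y $ i) = m $ i" for i
    unfolding m_def using integral_inner_left[OF int, of "axis i 1"]
    by (simp add: inner_axis)
  have meas: "(\<lambda>z. X z $ i) \<in> borel_measurable D" for i
    using borel_measurable_inner[OF X(1) borel_measurable_const[of "axis i 1"]] by (simp add: inner_axis)
  show i2: "integrable D (\<lambda>z. (norm (X z - (LINT y|D. X y)))\<^sup>2)"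
    unfolding m_def[symmetric]
  proof (rule Bochner_Integration.integrable_bound)
    show "integrable D (\<lambda>z. 2 * (norm (X z))\<^sup>2 + 2 * (norm m)\<^sup>2)" using X by simp
    show "AE z in D. norm ((norm (X z - m))\<^sup>2) \<le> norm (2 * (norm (X z))\<^sup>2 + 2 * (norm m)\<^sup>2)"
    proof (rule AE_I2)
      fix z
      have "(norm (X z - m))\<^sup>2 \<le> (norm (X z) + norm m)\<^sup>2"
        by (intro power_mono norm_triangle_ineq4) auto
      also have "\<dots> \<le> 2 * (norm (X z))\<^sup>2 + 2 * (norm m)\<^sup>2"
        using zero_le_power2[of "norm (X z) - norm m"] by (simp add: power2_sum power2_diff)
      finally show "norm ((norm (X z - m))\<^sup>2) \<le> norm (2 * (norm (X z))\<^sup>2 + 2 * (norm m)\<^sup>2)" by simp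
    qed
  qed (use X in auto)
  have sum: "(norm y)\<^sup>2 = (\<Sum>i\<in>UNIV. (y $ i)\<^sup>2)" for y :: "real^'d"
    unfolding power2_norm_eq_inner by (simp add: inner_vec_def power2_eq_square)
  have "integrable D (\<lambda>z. (X z $ i - m $ i)\<^sup>2)" for i
  proof (rule Bochner_Integration.integrable_bound[OF i2])
    show "AE z in D. norm ((X z $ i - m $ i)\<^sup>2) \<le> norm ((norm (X z - (LINT y|D. X y)))\<^sup>2)"
    proof (rule AE_I2)
      fix z show "norm ((X z $ i - m $ i)\<^sup>2) \<le> norm ((norm (X z - (LINT y|D. X y)))\<^sup>2)"
        using power_mono[OF component_le_norm_cart[of "X z - m" i], of 2] by (simp add: m_def[symmetric])
    qed
  qed (use meas in measurable)
  then show "(LINT z|D. (norm (X z - (LINT y|D. X y)))\<^sup>2) = (\<Sum>i\<in>UNIV. cov_matrix D X $ i $ i)"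
    unfolding m_def[symmetric] sum
    by (simp add: cov_matrix_def mi power2_eq_square)
qed

text \<open>Independence is expressed by product laws of pairs, because samples, coins and iterates take
  values in different types.\<close>
lemma (in prob_space) joint_law_of_disjoint_blocks:
  assumes indep: "indep_sets E I" and blocks: "J \<subseteq> I" "K \<subseteq> I" "J \<inter> K = {}"
    and Int_stable: "\<And>i. i \<in> I \<Longrightarrow> Int_stable (E i)"
    and X: "X \<in> measurable (sigma (space M) (\<Union>i\<in>J. E i)) N"
    and Y: "Y \<in> measurable (sigma (space M) (\<Union>i\<in>K. E i)) N'"
  shows "distr M (N \<Otimes>\<^sub>M N') (\<lambda>w. (X w, Y w)) = distr M N X \<Otimes>\<^sub>M distr M N' Y"
proof -
  have ev: "E i \<subseteq> events" if "i \<in> I" for i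
    using indep that by (auto simp: indep_sets_def)
  have sub: "(\<Union>i\<in>H. E i) \<subseteq> Pow (space M)" if "H \<subseteq> I" for H
    using ev that sets.sets_into_space by blast
  have "(\<Union>b\<in>UNIV. case_bool J K b) = J \<union> K" by (auto simp: UNIV_bool)
  then have "indep_sets (\<lambda>b. sigma_sets (space M) (\<Union>i\<in>case_bool J K b. E i)) UNIV"
    using blocks by (intro indep_sets_collect_sigma indep_sets_mono_index[OF _ indep] Int_stable)
      (auto simp: disjoint_family_on_def split: bool.splits)
  then have ind: "indep_set (sigma_sets (space M) (\<Union>i\<in>J. E i)) (sigma_sets (space M) (\<Union>i\<in>K. E i))"
    unfolding indep_set_def by (rule indep_sets_mono_sets) (auto split: bool.split)
  have le: "sigma_sets (space M) (\<Union>i\<in>H. E i) \<subseteq> events" if "H \<subseteq> I" for H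
    using that ev by (intro sets.sigma_sets_subset) blast
  have XM: "X \<in> measurable M N"
    using X le[OF blocks(1)] sub[OF blocks(1)] sets.space_closed[of M]
    by (auto simp: measurable_def sets_measure_of space_measure_of_conv)
  have YM: "Y \<in> measurable M N'"
    using Y le[OF blocks(2)] sub[OF blocks(2)] sets.space_closed[of M]
    by (auto simp: measurable_def sets_measure_of space_measure_of_conv)
  interpret X: prob_space "distr M N X" by (rule prob_space_distr[OF XM])
  interpret Y: prob_space "distr M N' Y" by (rule prob_space_distr[OF YM])
  show ?thesis
  proof (rule pair_measure_eqI[symmetric])
    show "sigma_finite_measure (distr M N X)" "sigma_finite_measure (distr M N' Y)"
      by unfold_locales
    show "sets (distr M N X \<Otimes>\<^sub>M distr M N' Y) = sets (distr M (N \<Otimes>\<^sub>M N') (\<lambda>w. (X w, Y w)))"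
      by (simp cong: sets_pair_measure_cong)
    fix A B assume "A \<in> sets (distr M N X)" "B \<in> sets (distr M N' Y)"
    then have A: "A \<in> sets N" and B: "B \<in> sets N'" by simp_all
    have A': "X -` A \<inter> space M \<in> sigma_sets (space M) (\<Union>i\<in>J. E i)"
      using measurable_sets[OF X A] sub[OF blocks(1)] by (simp add: sets_measure_of space_measure_of_conv)
    have B': "Y -` B \<inter> space M \<in> sigma_sets (space M) (\<Union>i\<in>K. E i)"
      using measurable_sets[OF Y B] sub[OF blocks(2)] by (simp add: sets_measure_of space_measure_of_conv)
    have XY: "(\<lambda>w. (X w, Y w)) \<in> measurable M (N \<Otimes>\<^sub>M N')" using XM YM by simp
    have "emeasure (distr M (N \<Otimes>\<^sub>M N') (\<lambda>w. (X w, Y w))) (A \<times> B)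
        = emeasure M ((X -` A \<inter> space M) \<inter> (Y -` B \<inter> space M))"
      using A B XY by (subst emeasure_distr) (auto intro!: arg_cong[where f = "emeasure M"])
    also have "\<dots> = emeasure (distr M N X) A * emeasure (distr M N' Y) B"
      using indep_setD[OF ind A' B'] A B XM YM by (simp add: emeasure_eq_measure emeasure_distr ennreal_mult)
    finally show "emeasure (distr M N X) A * emeasure (distr M N' Y) B
        = emeasure (distr M (N \<Otimes>\<^sub>M N') (\<lambda>w. (X w, Y w))) (A \<times> B)" by simp
  qed
qed

text \<open>The freezing lemma: an argument independent of the past may be integrated out with the past held fixed.\<close>
lemma (in prob_space) nn_integral_independent:
  assumes X: "X \<in> measurable M N" and Z: "Z \<in> measurable M D"
    and joint: "distr M (N \<Otimes>\<^sub>M D) (\<lambda>w. (X w, Z w)) = distr M N X \<Otimes>\<^sub>M D"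
    and D: "sigma_finite_measure D"
    and h: "h \<in> borel_measurable (N \<Otimes>\<^sub>M D)"
  shows "(\<integral>\<^sup>+w. h (X w, Z w) \<partial>M) = (\<integral>\<^sup>+w. (\<integral>\<^sup>+z. h (X w, z) \<partial>D) \<partial>M)"
proof -
  interpret D: sigma_finite_measure D by fact
  have h': "h \<in> borel_measurable (distr M N X \<Otimes>\<^sub>M D)"
    using h by (simp cong: measurable_cong_sets add: sets_pair_measure_cong[OF sets_distr refl])
  have "(\<integral>\<^sup>+w. h (X w, Z w) \<partial>M) = (\<integral>\<^sup>+q. h q \<partial>(distr M N X \<Otimes>\<^sub>M D))"
    using X Z h by (simp add: joint[symmetric] nn_integral_distr)
  also have "\<dots> = (\<integral>\<^sup>+s. (\<integral>\<^sup>+z. h (s, z) \<partial>D) \<partial>distr M N X)"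
    using h' by (rule D.nn_integral_fst[symmetric])
  also have "\<dots> = (\<integral>\<^sup>+w. (\<integral>\<^sup>+z. h (X w, z) \<partial>D) \<partial>M)"
    using X by (rule nn_integral_distr) (use h in measurable)
  finally show ?thesis .
qed

text \<open>The cross term between \<open>G\<close> and the noise vanishes after integrating out \<open>Z\<close>, since the noise is centered
  for every fixed value of \<open>X\<close>. Finiteness is obtained along the way by computing with the nonnegative integral.\<close>
lemma (in prob_space) second_moment_add_centered:
  fixes G :: "'a \<Rightarrow> 'v::euclidean_space" and n :: "'v \<Rightarrow> 'z \<Rightarrow> 'v"
  assumes G_meas: "G \<in> borel_measurable M" and X_meas: "X \<in> borel_measurable M" and Z: "Z \<in> measurable M D"
    and joint: "distr M ((borel \<Otimes>\<^sub>M borel) \<Otimes>\<^sub>M D) (\<lambda>w. ((G w, X w), Z w))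
      = distr M (borel \<Otimes>\<^sub>M borel) (\<lambda>w. (G w, X w)) \<Otimes>\<^sub>M D"
    and D: "prob_space D"
    and n_meas: "(\<lambda>(y, z). n y z) \<in> borel_measurable (borel \<Otimes>\<^sub>M D)"
    and n_int: "\<And>y. integrable D (n y)" and centered: "\<And>y. (LINT z|D. n y z) = 0"
    and n_sq: "\<And>y. integrable D (\<lambda>z. (norm (n y z))\<^sup>2)"
    and var: "\<And>y. (LINT z|D. (norm (n y z))\<^sup>2) \<le> V y"
    and G: "integrable M (\<lambda>w. (norm (G w))\<^sup>2)" and V: "integrable M (\<lambda>w. V (X w))"
  shows "integrable M (\<lambda>w. (norm (G w + n (X w) (Z w)))\<^sup>2)"
    and "(LINT w|M. (norm (G w + n (X w) (Z w)))\<^sup>2) \<le> (LINT w|M. (norm (G w))\<^sup>2) + (LINT w|M. V (X w))"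
proof -
  interpret D: prob_space D by fact
  have V0: "0 \<le> V y" for y
    by (rule order_trans[OF Bochner_Integration.integral_nonneg var]) simp
  have inner: "(\<integral>\<^sup>+z. ennreal ((norm (q + n y z))\<^sup>2) \<partial>D) \<le> ennreal ((norm q)\<^sup>2 + V y)" for q y
  proof -
    have eq: "(norm (q + n y z))\<^sup>2 = (norm q)\<^sup>2 + (2 * (q \<bullet> n y z) + (norm (n y z))\<^sup>2)" for z
      unfolding power2_norm_eq_inner by (simp add: inner_add_left inner_add_right inner_commute)
    have int: "integrable D (\<lambda>z. (norm (q + n y z))\<^sup>2)"
      unfolding eq using n_int n_sq by simp
    have "(LINT z|D. (norm (q + n y z))\<^sup>2) = (norm q)\<^sup>2 + (LINT z|D. (norm (n y z))\<^sup>2)"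
      unfolding eq using n_int n_sq centered by (simp add: D.prob_space)
    then show ?thesis
      using int var[of y] by (subst nn_integral_eq_integral) (auto simp del: ennreal_plus intro!: ennreal_leI)
  qed
  have meas: "(\<lambda>w. (norm (G w + n (X w) (Z w)))\<^sup>2) \<in> borel_measurable M"
    using measurable_compose[OF measurable_Pair[OF X_meas Z] n_meas] G_meas by simp
  have [measurable]: "(\<lambda>s. n (snd (fst s)) (snd s)) \<in> borel_measurable ((borel \<Otimes>\<^sub>M borel) \<Otimes>\<^sub>M D)"
    using measurable_compose[OF _ n_meas, of "\<lambda>s. (snd (fst s), snd s)" "(borel \<Otimes>\<^sub>M borel) \<Otimes>\<^sub>M D"]
    by simp
  have hm: "(\<lambda>((q, y), z). ennreal ((norm (q + n y z))\<^sup>2)) \<in> borel_measurable ((borel \<Otimes>\<^sub>M borel) \<Otimes>\<^sub>M D)"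
    unfolding split_beta' by measurable
  have "(\<integral>\<^sup>+w. ennreal ((norm (G w + n (X w) (Z w)))\<^sup>2) \<partial>M)
      = (\<integral>\<^sup>+w. (\<integral>\<^sup>+z. ennreal ((norm (G w + n (X w) z))\<^sup>2) \<partial>D) \<partial>M)"
    using nn_integral_independent[OF measurable_Pair[OF G_meas X_meas] Z joint _ hm] D.sigma_finite_measure_axioms
    by simp
  also have "\<dots> \<le> (\<integral>\<^sup>+w. ennreal ((norm (G w))\<^sup>2 + V (X w)) \<partial>M)"
    by (intro nn_integral_mono inner)
  also have "\<dots> = ennreal (LINT w|M. (norm (G w))\<^sup>2 + V (X w))"
    using G V V0 by (intro nn_integral_eq_integral) auto
  finally have le: "(\<integral>\<^sup>+w. ennreal ((norm (G w + n (X w) (Z w)))\<^sup>2) \<partial>M)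
      \<le> ennreal ((LINT w|M. (norm (G w))\<^sup>2) + (LINT w|M. V (X w)))"
    using G V by simp
  then show int: "integrable M (\<lambda>w. (norm (G w + n (X w) (Z w)))\<^sup>2)"
    using meas by (intro integrableI_bounded) (auto intro: le_less_trans)
  show "(LINT w|M. (norm (G w + n (X w) (Z w)))\<^sup>2) \<le> (LINT w|M. (norm (G w))\<^sup>2) + (LINT w|M. V (X w))"
    using le V0
    by (simp add: nn_integral_eq_integral[OF int] integral_nonneg_AE add_nonneg_nonneg del: ennreal_plus)
qed

lemma (in prob_space) expectation_coin:
  fixes Y :: "'a \<Rightarrow> real"
  assumes \<omega>: "\<omega> \<in> measurable M (count_space UNIV)"
    and joint: "distr M (borel \<Otimes>\<^sub>M count_space UNIV) (\<lambda>w. (Y w, \<omega> w))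
      = distr M borel Y \<Otimes>\<^sub>M measure_pmf (bernoulli_pmf q)"
    and distr: "distr M (count_space UNIV) \<omega> = measure_pmf (bernoulli_pmf q)" and q: "0 \<le> q" "q \<le> 1"
    and Y: "integrable M Y" and Y0: "\<And>w. 0 \<le> Y w"
  shows "integrable M (\<lambda>w. if \<omega> w then 0 else Y w)"
    and "(LINT w|M. (if \<omega> w then 0 else Y w)) = (1 - q) * (LINT w|M. Y w)"
proof -
  let ?B = "measure_pmf (bernoulli_pmf q)"
  have Ym: "Y \<in> borel_measurable M" using Y by simp
  have \<omega>': "\<omega> \<in> measurable M ?B" using \<omega> by (simp cong: measurable_cong_sets)
  have h: "(\<lambda>(y, b). ennreal (if b then 0 else y)) \<in> borel_measurable (borel \<Otimes>\<^sub>M ?B)"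
    by (simp add: split_beta' cong: measurable_cong_sets sets_pair_measure_cong)
  have joint': "distr M (borel \<Otimes>\<^sub>M ?B) (\<lambda>w. (Y w, \<omega> w)) = distr M borel Y \<Otimes>\<^sub>M ?B"
    unfolding joint[symmetric] by (intro distr_cong sets_pair_measure_cong) auto
  have inner: "(\<integral>\<^sup>+b. ennreal (if b then 0 else y) \<partial>?B) = ennreal (1 - q) * ennreal y" for y :: real
    using q by (simp add: nn_integral_bernoulli_pmf mult.commute)
  have nn: "(\<integral>\<^sup>+w. ennreal (if \<omega> w then 0 else Y w) \<partial>M) = ennreal ((1 - q) * (LINT w|M. Y w))"
  proof -
    have "(\<integral>\<^sup>+w. ennreal (if \<omega> w then 0 else Y w) \<partial>M) = (\<integral>\<^sup>+w. ennreal (1 - q) * ennreal (Y w) \<partial>M)"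
      using nn_integral_independent[OF Ym \<omega>' joint' measure_pmf.sigma_finite_measure_axioms h]
      by (simp add: inner)
    then show ?thesis
      using Ym Y Y0 q by (simp add: nn_integral_cmult nn_integral_eq_integral ennreal_mult Bochner_Integration.integral_nonneg)
  qed
  show int: "integrable M (\<lambda>w. if \<omega> w then 0 else Y w)"
    using nn Y0 Ym \<omega> by (intro integrableI_bounded) auto
  show "(LINT w|M. (if \<omega> w then 0 else Y w)) = (1 - q) * (LINT w|M. Y w)"
    using nn Y0 q by (simp add: nn_integral_eq_integral[OF int] Bochner_Integration.integral_nonneg)
qed

section \<open>Splitting the iterates into an excursion and a residual\<close>

text \<open>The algorithm for a coercive linear \<open>S\<close> and an abstract projection \<open>Q\<close>. The gradient at \<open>y\<close> is
  \<open>S (y - x\<^sup>*) + c\<close>, and the noise variance may grow quadratically in the distance to \<open>x\<^sup>*\<close>.\<close>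
locale projected_sgd = prob_space M for M :: "'w measure" +
  fixes D :: "'z measure" and g :: "'v::euclidean_space \<Rightarrow> 'z \<Rightarrow> 'v"
    and \<zeta> :: "nat \<Rightarrow> 'w \<Rightarrow> 'z" and \<omega> :: "nat \<Rightarrow> 'w \<Rightarrow> bool" and x :: "nat \<Rightarrow> 'w \<Rightarrow> 'v"
    and S Q :: "'v \<Rightarrow> 'v" and c xstar x1 :: 'v
    and \<eta> p :: "nat \<Rightarrow> real" and \<mu> K0 K1 :: real and k :: nat
  assumes S: "linear S" and coercive: "\<And>v. \<mu> * (norm v)\<^sup>2 \<le> v \<bullet> S v"
    and Q: "linear Q" "\<And>v. Q (Q v) = Q v" "\<And>v. norm (Q v) \<le> norm v" "\<And>v. norm (v - Q v) \<le> norm v"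
    and Q_xstar: "Q xstar = xstar" and Q_krylov: "\<And>i. i < k \<Longrightarrow> Q ((S ^^ i) c) = 0"
    and D: "prob_space D"
    and g_meas: "(\<lambda>(y, z). g y z) \<in> borel_measurable (borel \<Otimes>\<^sub>M D)"
    and g_int: "\<And>y. integrable D (g y)"
    and g_mean: "\<And>y. (LINT z|D. g y z) = S (y - xstar) + c"
    and g_sq: "\<And>y. integrable D (\<lambda>z. (norm (g y z - (S (y - xstar) + c)))\<^sup>2)"
    and g_var: "\<And>y. (LINT z|D. (norm (g y z - (S (y - xstar) + c)))\<^sup>2) \<le> K0 + K1 * (norm (y - xstar))\<^sup>2"
    and K: "0 \<le> K0" "0 \<le> K1"
    and \<zeta>_meas: "\<And>n. n \<ge> 1 \<Longrightarrow> \<zeta> n \<in> measurable M D"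
    and \<zeta>_distr: "\<And>n. n \<ge> 1 \<Longrightarrow> distr M D (\<zeta> n) = D"
    and \<omega>_meas: "\<And>n. n \<ge> 1 \<Longrightarrow> \<omega> n \<in> measurable M (count_space UNIV)"
    and \<omega>_distr: "\<And>n. n \<ge> 1 \<Longrightarrow> distr M (count_space UNIV) (\<omega> n) = measure_pmf (bernoulli_pmf (p n))"
    and p: "\<And>n. n \<ge> 1 \<Longrightarrow> 0 < p n" "\<And>n. n \<ge> 1 \<Longrightarrow> p n \<le> 1"
    and \<eta>: "\<And>n. n \<ge> 1 \<Longrightarrow> 0 < \<eta> n"
    and indep: "samples_coins_independent M D \<zeta> \<omega>"
    and x_init: "\<And>w. w \<in> space M \<Longrightarrow> x 1 w = x1"
    and x_step: "\<And>n w. n \<ge> 1 \<Longrightarrow> w \<in> space M \<Longrightarrow> x (Suc n) w =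
      (if \<omega> n w then Q (x n w - \<eta> n *\<^sub>R g (x n w) (\<zeta> n w)) else x n w - \<eta> n *\<^sub>R g (x n w) (\<zeta> n w))"
begin

lemma bounded_linear_S: "bounded_linear S" and bounded_linear_Q: "bounded_linear Q"
  using S Q(1) by (simp_all add: linear_conv_bounded_linear)

lemma S_meas [measurable]: "S \<in> borel_measurable borel" and Q_meas [measurable]: "Q \<in> borel_measurable borel"
  using bounded_linear_S bounded_linear_Q
  by (auto intro!: borel_measurable_continuous_onI linear_continuous_on)

lemma g_comp_meas [measurable (raw)]:
  assumes [measurable]: "f \<in> borel_measurable N" "h \<in> measurable N D"
  shows "(\<lambda>w. g (f w) (h w)) \<in> borel_measurable N"
  using measurable_compose[OF measurable_Pair[OF assms] g_meas] by simp

text \<open>\<open>coef n j\<close> is up to sign the \<open>j\<close>-fold iterated sum of the step sizes since the last projection, about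
  \<open>(- \<tau>)\<^sup>j / j!\<close> for elapsed time \<open>\<tau>\<close>. Index \<open>0\<close> is the constant source that drives the chain. The case
  \<open>n = 0\<close> in the recursion treats the deterministic start at time \<open>1\<close> like a projection, so all
  coefficients of positive index vanish there.\<close>
fun coef :: "nat \<Rightarrow> nat \<Rightarrow> 'w \<Rightarrow> real" where
  "coef 0 j w = of_bool (j = 0)"
| "coef (Suc n) 0 w = 1"
| "coef (Suc n) (Suc j) w =
     (if n = 0 \<or> \<omega> n w then 0 else coef n (Suc j) w - \<eta> n * coef n j w)"

lemma coef_0 [simp]: "coef n 0 w = 1"
  by (cases n) auto

definition excursion :: "nat \<Rightarrow> 'w \<Rightarrow> 'v" where
  "excursion n w = (\<Sum>i<k. coef n (Suc i) w *\<^sub>R (S ^^ i) c)"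

definition residual :: "nat \<Rightarrow> 'w \<Rightarrow> 'v" where
  "residual n w = x n w - xstar - excursion n w"

definition leading :: 'v where "leading = (S ^^ k) c"

text \<open>The force that acts on the residual; compared with the gradient, \<open>c\<close> is replaced by
  \<open>coef n k\<close> times the \<open>k\<close>-th Krylov vector.\<close>
definition slope :: "nat \<Rightarrow> 'w \<Rightarrow> 'v" where
  "slope n w = S (residual n w) + coef n k w *\<^sub>R leading"

definition noise :: "'v \<Rightarrow> 'z \<Rightarrow> 'v" where
  "noise y s = S (y - xstar) + c - g y s"

lemma Q_excursion: "Q (excursion n w) = 0"
  unfolding excursion_def by (simp add: linear_sum[OF Q(1)] linear_cmul[OF Q(1)] Q_krylov)

text \<open>Applying \<open>S\<close> shifts the Krylov vectors by one. The constant force \<open>c\<close> fills the free place at index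
  \<open>0\<close>, and the vector pushed out at index \<open>k\<close> is the only one that \<open>Q\<close> can see.\<close>
lemma S_excursion: "S (excursion n w) + c = (\<Sum>i<k. coef n i w *\<^sub>R (S ^^ i) c) + coef n k w *\<^sub>R leading"
proof -
  have "S (excursion n w) = (\<Sum>i<k. coef n (Suc i) w *\<^sub>R (S ^^ Suc i) c)"
    unfolding excursion_def by (simp add: linear_sum[OF S] linear_cmul[OF S])
  also have "c + \<dots> = (\<Sum>i<Suc k. coef n i w *\<^sub>R (S ^^ i) c)"
    by (subst sum.lessThan_Suc_shift) simp
  finally show ?thesis by (simp add: leading_def add.commute)
qed

text \<open>The reason for the decomposition: the residual evolves by the same projected iteration, but without the
  constant force \<open>c\<close>.\<close>
lemma residual_Suc:
  assumes n: "n \<ge> 1" and w: "w \<in> space M"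
  defines "Y \<equiv> residual n w - \<eta> n *\<^sub>R slope n w + \<eta> n *\<^sub>R noise (x n w) (\<zeta> n w)"
  shows "residual (Suc n) w = (if \<omega> n w then Q Y else Y)"
proof -
  \<comment> \<open>The excursion that the iteration would reach without a projection. It is annihilated by \<open>Q\<close>,
    so the projection acts on the residual only.\<close>
  define y' where "y' = excursion n w - \<eta> n *\<^sub>R (\<Sum>i<k. coef n i w *\<^sub>R (S ^^ i) c)"
  have Qy': "Q y' = 0"
    unfolding y'_def
    by (simp add: linear_diff[OF Q(1)] linear_cmul[OF Q(1)] Q_excursion linear_sum[OF Q(1)] Q_krylov)
  have "S (x n w - xstar) + c = S (residual n w) + (S (excursion n w) + c)"
    by (simp add: residual_def linear_diff[OF S])
  then have half: "x n w - \<eta> n *\<^sub>R g (x n w) (\<zeta> n w) - xstar = Y + y'"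
    unfolding Y_def noise_def slope_def y'_def S_excursion by (simp add: residual_def algebra_simps)
  show ?thesis
  proof (cases "\<omega> n w")
    case True
    have "excursion (Suc n) w = 0" using True by (simp add: excursion_def)
    then have "residual (Suc n) w = Q (x n w - \<eta> n *\<^sub>R g (x n w) (\<zeta> n w) - xstar)"
      using True n w by (simp add: residual_def x_step linear_diff[OF Q(1)] Q_xstar)
    also have "\<dots> = Q Y" unfolding half by (simp add: linear_add[OF Q(1)] Qy')
    finally show ?thesis using True by simp
  next
    case False
    have "excursion (Suc n) w = y'"
      using False n by (simp add: excursion_def y'_def sum_subtractf scaleR_sum_right algebra_simps)
    then show ?thesis
      using False n w half by (simp add: residual_def x_step algebra_simps)
  qed
qed

lemma Q_x: "Q (x n w) - xstar = Q (residual n w)"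
  by (simp add: residual_def linear_diff[OF Q(1)] Q_xstar Q_excursion)

lemma normal_part_x: "x n w - Q (x n w) = (residual n w - Q (residual n w)) + excursion n w"
  unfolding residual_def by (simp add: linear_diff[OF Q(1)] Q_xstar Q_excursion)

text \<open>The excursion contributes to \<open>Q S P x\<^sub>n\<close> only through the vector that \<open>S\<close> pushes out of the span
  of the first \<open>k\<close> Krylov vectors.\<close>
lemma QS_normal_part:
  assumes "k \<ge> 1"
  shows "Q (S (x n w - Q (x n w))) = Q (S (residual n w - Q (residual n w))) + coef n k w *\<^sub>R Q leading"
proof -
  have "Q (S (excursion n w) + c) = coef n k w *\<^sub>R Q leading"
    unfolding S_excursion by (simp add: linear_add[OF Q(1)] linear_sum[OF Q(1)] linear_cmul[OF Q(1)] Q_krylov)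
  moreover have "Q c = 0" using Q_krylov[of 0] assms by simp
  ultimately show ?thesis
    unfolding normal_part_x by (simp add: linear_add[OF Q(1)] linear_add[OF S])
qed

section \<open>Measurability with respect to the past\<close>

abbreviation source :: "nat + nat \<Rightarrow> 'w set set" where
  "source \<equiv> case_sum (\<lambda>n. sets (vimage_algebra (space M) (\<zeta> n) D))
                       (\<lambda>n. sets (vimage_algebra (space M) (\<omega> n) (count_space UNIV)))"

text \<open>The \<open>\<sigma>\<close>-algebra generated by a set of sources, as a measurable space; \<open>Inl n\<close> stands for the sample
  and \<open>Inr n\<close> for the coin of step \<open>n\<close>.\<close>
definition hist :: "(nat + nat) set \<Rightarrow> 'w measure" where
  "hist J = sigma (space M) (\<Union>i\<in>J. source i)"

lemma source_sub: "(\<Union>i\<in>J. source i) \<subseteq> Pow (space M)"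
proof -
  have "source i \<subseteq> Pow (space M)" for i
    using sets.space_closed[of "vimage_algebra (space M) f N" for f :: "'w \<Rightarrow> 'z" and N]
      sets.space_closed[of "vimage_algebra (space M) f N" for f :: "'w \<Rightarrow> bool" and N]
    by (cases i) simp_all
  then show ?thesis by blast
qed

lemma space_hist [simp]: "space (hist J) = space M"
  by (simp add: hist_def space_measure_of_conv)

lemma sets_hist: "sets (hist J) = sigma_sets (space M) (\<Union>i\<in>J. source i)"
  unfolding hist_def using source_sub by (simp add: sets_measure_of)

lemma measurable_hist_mono:
  assumes "f \<in> measurable (hist J) N" "J \<subseteq> K"
  shows "f \<in> measurable (hist K) N"
proof -
  have "sets (hist J) \<subseteq> sets (hist K)"
    unfolding sets_hist using assms(2) by (intro sigma_sets_mono') auto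
  then show ?thesis using assms(1) by (auto simp: measurable_def)
qed

lemma source_measurable:
  assumes "n \<ge> 1"
  shows "Inl n \<in> J \<Longrightarrow> \<zeta> n \<in> measurable (hist J) D"
    and "Inr n \<in> J \<Longrightarrow> \<omega> n \<in> measurable (hist J) (count_space UNIV)"
proof -
  have *: "f \<in> measurable (hist J) N"
    if "f \<in> measurable M N" "sets (vimage_algebra (space M) f N) = source i" "i \<in> J" for f i and N :: "'b measure"
  proof -
    have "f -` A \<inter> space M \<in> sets (hist J)" if A: "A \<in> sets N" for A
    proof -
      have "f -` A \<inter> space M \<in> source i"
        using in_vimage_algebra[OF A] \<open>sets _ = source i\<close> by metis
      then show ?thesis using \<open>i \<in> J\<close> unfolding sets_hist by (intro sigma_sets.Basic) auto
    qed
    then show ?thesis using \<open>f \<in> measurable M N\<close> by (auto simp: measurable_def)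
  qed
  show "Inl n \<in> J \<Longrightarrow> \<zeta> n \<in> measurable (hist J) D"
    using \<zeta>_meas[OF assms] by (intro *[of _ _ "Inl n"]) auto
  show "Inr n \<in> J \<Longrightarrow> \<omega> n \<in> measurable (hist J) (count_space UNIV)"
    using \<omega>_meas[OF assms] by (intro *[of _ _ "Inr n"]) auto
qed

definition past :: "nat \<Rightarrow> (nat + nat) set" where
  "past n = {1..<n} <+> {1..<n}"

lemma hist_measurable_M:
  assumes "f \<in> measurable (hist J) N" "J \<subseteq> {1..} <+> {1..}"
  shows "f \<in> measurable M N"
proof -
  have "source i \<subseteq> events" if "i \<in> J" for i
    using indep that assms(2) unfolding samples_coins_independent_def indep_sets_def by blast
  then have "sets (hist J) \<subseteq> events"
    unfolding sets_hist by (intro sets.sigma_sets_subset) auto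
  then show ?thesis using assms(1) by (auto simp: measurable_def)
qed

lemma joint_law_hist:
  assumes J: "J \<subseteq> {1..} <+> {1..}" and K: "K \<subseteq> {1..} <+> {1..}" and "J \<inter> K = {}"
    and f: "f \<in> measurable (hist J) N" and f': "f' \<in> measurable (hist K) N'"
  shows "distr M (N \<Otimes>\<^sub>M N') (\<lambda>w. (f w, f' w)) = distr M N f \<Otimes>\<^sub>M distr M N' f'"
proof (rule joint_law_of_disjoint_blocks[where E = source and I = "{1..} <+> {1..}"])
  show "indep_sets source ({1..} <+> {1..})"
    using indep by (simp add: samples_coins_independent_def)
  show "Int_stable (source i)" for i
    by (auto simp: Int_stable_def split: sum.splits)
qed (use assms in \<open>simp_all add: hist_def\<close>)

lemma past_sub: "past n \<subseteq> {1..} <+> {1..}" "past n \<subseteq> insert (Inl n) (past n)"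
    "n \<ge> 1 \<Longrightarrow> insert (Inl n) (past n) \<subseteq> {1..} <+> {1..}" "past n \<subseteq> past (Suc n)"
    "n \<ge> 1 \<Longrightarrow> Inl n \<in> past (Suc n)" "n \<ge> 1 \<Longrightarrow> Inr n \<in> past (Suc n)"
  by (auto simp: past_def)

lemma joint_law_sample:
  assumes n: "n \<ge> 1" and f: "f \<in> measurable (hist (past n)) N"
  shows "distr M (N \<Otimes>\<^sub>M D) (\<lambda>w. (f w, \<zeta> n w)) = distr M N f \<Otimes>\<^sub>M D"
proof -
  have "{Inl n} \<subseteq> {1..} <+> {1..}" "past n \<inter> {Inl n} = {}"
    using n by (auto simp: past_def)
  from joint_law_hist[OF past_sub(1) this f source_measurable(1)[OF n]] show ?thesis
    by (simp add: \<zeta>_distr[OF n])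
qed

text \<open>The coin of step \<open>n\<close> is tossed after the sample of that step, so it is independent of the half step as
  well.\<close>
lemma joint_law_coin:
  assumes n: "n \<ge> 1" and f: "f \<in> measurable (hist (insert (Inl n) (past n))) N"
  shows "distr M (N \<Otimes>\<^sub>M count_space UNIV) (\<lambda>w. (f w, \<omega> n w))
    = distr M N f \<Otimes>\<^sub>M measure_pmf (bernoulli_pmf (p n))"
proof -
  have "{Inr n} \<subseteq> {1..} <+> {1..}" "insert (Inl n) (past n) \<inter> {Inr n} = {}"
    using n by (auto simp: past_def)
  from joint_law_hist[OF past_sub(3)[OF n] this f source_measurable(2)[OF n]] show ?thesis
    by (simp add: \<omega>_distr[OF n])
qed

lemma x_hist: "n \<ge> 1 \<Longrightarrow> x n \<in> borel_measurable (hist (past n))"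
proof (induction n rule: nat_induct_at_least)
  case base
  show ?case
    using x_init by (subst measurable_cong[of _ _ "\<lambda>_. x1"]) auto
next
  case (Suc n)
  let ?H = "hist (past (Suc n))"
  have [measurable]: "x n \<in> borel_measurable ?H" "\<zeta> n \<in> measurable ?H D" "\<omega> n \<in> measurable ?H (count_space UNIV)"
    using measurable_hist_mono[OF Suc.IH past_sub(4)] source_measurable[OF Suc.hyps] past_sub(5,6)[OF Suc.hyps]
    by auto
  show ?case
    using Suc.hyps by (subst measurable_cong[OF x_step]) auto
qed

lemma coef_hist: "coef n j \<in> borel_measurable (hist (past n))"
proof (induction n arbitrary: j)
  case 0
  then show ?case by simp
next
  case (Suc n)
  let ?H = "hist (past (Suc n))"
  have [measurable]: "coef n i \<in> borel_measurable ?H" for i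
    using measurable_hist_mono[OF Suc.IH past_sub(4)] .
  show ?case
  proof (cases "j = 0 \<or> n = 0")
    case True
    then show ?thesis by (cases j) auto
  next
    case False
    then have [measurable]: "\<omega> n \<in> measurable ?H (count_space UNIV)"
      using source_measurable(2)[of n] past_sub(6)[of n] by simp
    from False show ?thesis by (cases j) auto
  qed
qed

lemma residual_hist:
  assumes "n \<ge> 1" shows "residual n \<in> borel_measurable (hist (past n))"
proof -
  note [measurable] = x_hist[OF assms] coef_hist
  show ?thesis unfolding residual_def[abs_def] excursion_def by measurable
qed

lemma slope_hist:
  assumes "n \<ge> 1" shows "slope n \<in> borel_measurable (hist (past n))"
proof -
  note [measurable] = residual_hist[OF assms] coef_hist
  show ?thesis unfolding slope_def[abs_def] by measurable
qed

lemma noise_comp_meas [measurable (raw)]: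
  assumes [measurable]: "f \<in> borel_measurable N" "f' \<in> measurable N D"
  shows "(\<lambda>w. noise (f w) (f' w)) \<in> borel_measurable N"
  unfolding noise_def by measurable

lemmas x_meas [measurable] = hist_measurable_M[OF x_hist past_sub(1)]
lemmas coef_meas [measurable] = hist_measurable_M[OF coef_hist past_sub(1)]
lemmas residual_meas [measurable] = hist_measurable_M[OF residual_hist past_sub(1)]
lemmas slope_meas [measurable] = hist_measurable_M[OF slope_hist past_sub(1)]

lemma excursion_meas [measurable]: "excursion n \<in> borel_measurable M"
  unfolding excursion_def by measurable

section \<open>One-step inequalities for the second moments\<close>

text \<open>A quantity that a projection annihilates is multiplied, in second moment, by the probability that no
  projection takes place.\<close>
lemma expectation_survives:
  fixes Y :: "'w \<Rightarrow> 'u::euclidean_space"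
  assumes n: "n \<ge> 1" and Y: "Y \<in> borel_measurable (hist (insert (Inl n) (past n)))"
    and int: "integrable M (\<lambda>w. (norm (Y w))\<^sup>2)"
    and Y': "\<And>w. w \<in> space M \<Longrightarrow> Y' w = (if \<omega> n w then 0 else Y w)"
  shows "integrable M (\<lambda>w. (norm (Y' w))\<^sup>2)"
    and "(LINT w|M. (norm (Y' w))\<^sup>2) = (1 - p n) * (LINT w|M. (norm (Y w))\<^sup>2)"
proof -
  have "(\<lambda>w. (norm (Y w))\<^sup>2) \<in> borel_measurable (hist (insert (Inl n) (past n)))"
    using Y by measurable
  note coin = expectation_coin[OF \<omega>_meas[OF n] joint_law_coin[OF n this] \<omega>_distr[OF n] _ p(2)[OF n] int]
  have eq: "(norm (Y' w))\<^sup>2 = (if \<omega> n w then 0 else (norm (Y w))\<^sup>2)" if "w \<in> space M" for w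
    using Y'[OF that] by simp
  show "integrable M (\<lambda>w. (norm (Y' w))\<^sup>2)"
    using coin(1) p(1)[OF n] by (subst Bochner_Integration.integrable_cong[OF refl eq]) auto
  show "(LINT w|M. (norm (Y' w))\<^sup>2) = (1 - p n) * (LINT w|M. (norm (Y w))\<^sup>2)"
    using coin(2) p(1)[OF n] by (subst Bochner_Integration.integral_cong[OF refl eq]) auto
qed

lemma coef_sq_integrable: "n \<ge> 1 \<Longrightarrow> integrable M (\<lambda>w. (coef n j w)\<^sup>2)"
proof (induction n arbitrary: j rule: nat_induct_at_least)
  case base
  then show ?case by (cases j) auto
next
  case (Suc n)
  show ?case
  proof (cases j)
    case (Suc i)
    note [measurable] = measurable_hist_mono[OF coef_hist past_sub(2), of n]
    have "integrable M (\<lambda>w. (norm (coef n (Suc i) w + (- \<eta> n) *\<^sub>R coef n i w))\<^sup>2)"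
      using Suc.IH \<open>1 \<le> n\<close> by (intro integrable_norm_sq_add) (auto simp: power_mult_distrib)
    then have int: "integrable M (\<lambda>w. (norm (coef n (Suc i) w - \<eta> n * coef n i w))\<^sup>2)" by simp
    have "integrable M (\<lambda>w. (norm (coef (Suc n) (Suc i) w))\<^sup>2)"
    proof (rule expectation_survives(1)[OF \<open>1 \<le> n\<close> _ int])
      show "(\<lambda>w. coef n (Suc i) w - \<eta> n * coef n i w) \<in> borel_measurable (hist (insert (Inl n) (past n)))"
        by measurable
    qed (use \<open>1 \<le> n\<close> in simp)
    then show ?thesis using Suc by simp
  qed simp
qed

lemma coef_sq_step:
  assumes n: "n \<ge> 1"
  shows "(LINT w|M. (coef (Suc n) (Suc j) w)\<^sup>2) \<le>
    (1 - p n / 2) * (LINT w|M. (coef n (Suc j) w)\<^sup>2) + 2 / p n * (\<eta> n)\<^sup>2 * (LINT w|M. (coef n j w)\<^sup>2)"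
proof -
  note [measurable] = measurable_hist_mono[OF coef_hist past_sub(2), of n]
  note int [simp] = coef_sq_integrable[OF n]
  have i: "integrable M (\<lambda>w. (norm (coef n (Suc j) w + (- \<eta> n) *\<^sub>R coef n j w))\<^sup>2)"
    using n by (intro integrable_norm_sq_add) (auto simp: power_mult_distrib)
  have "(LINT w|M. (norm (coef (Suc n) (Suc j) w))\<^sup>2)
      = (1 - p n) * (LINT w|M. (norm (coef n (Suc j) w - \<eta> n * coef n j w))\<^sup>2)"
  proof (rule expectation_survives(2)[OF n])
    show "(\<lambda>w. coef n (Suc j) w - \<eta> n * coef n j w) \<in> borel_measurable (hist (insert (Inl n) (past n)))"
      by measurable
  qed (use n i in simp_all)
  also have "\<dots> = (LINT w|M. (1 - p n) * (norm (coef n (Suc j) w - \<eta> n * coef n j w))\<^sup>2)"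
    by simp
  also have "\<dots> \<le> (LINT w|M. (1 - p n / 2) * (coef n (Suc j) w)\<^sup>2 + 2 / p n * ((\<eta> n)\<^sup>2 * (coef n j w)\<^sup>2))"
  proof (rule integral_mono)
    fix w
    show "(1 - p n) * (norm (coef n (Suc j) w - \<eta> n * coef n j w))\<^sup>2
        \<le> (1 - p n / 2) * (coef n (Suc j) w)\<^sup>2 + 2 / p n * ((\<eta> n)\<^sup>2 * (coef n j w)\<^sup>2)"
      using survival_norm_diff_sq_le[OF p[OF n], of "coef n (Suc j) w" "\<eta> n * coef n j w"]
      by (simp add: power_mult_distrib)
  qed (use i in auto)
  finally show ?thesis by (simp add: mult.assoc)
qed

abbreviation second_moment :: "('w \<Rightarrow> 'u::real_normed_vector) \<Rightarrow> real" where
  "second_moment X \<equiv> (LINT w|M. (norm (X w))\<^sup>2)"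

lemma excursion_sq_le: "(norm (excursion n w))\<^sup>2 \<le> (\<Sum>i<k. (coef n (Suc i) w)\<^sup>2 * (norm ((S ^^ i) c))\<^sup>2) * k"
proof -
  have "(norm (excursion n w))\<^sup>2 \<le> (\<Sum>i<k. \<bar>coef n (Suc i) w\<bar> * norm ((S ^^ i) c))\<^sup>2"
    unfolding excursion_def by (intro power_mono sum_norm_le) auto
  also have "\<dots> \<le> (\<Sum>i<k. (\<bar>coef n (Suc i) w\<bar> * norm ((S ^^ i) c))\<^sup>2) * k"
    using sum_squared_le_sum_of_squares[of "\<lambda>i. \<bar>coef n (Suc i) w\<bar> * norm ((S ^^ i) c)" "{..<k}"] by simp
  finally show ?thesis by (simp add: power_mult_distrib)
qed

lemma excursion_sq_integrable:
  assumes "n \<ge> 1" shows "integrable M (\<lambda>w. (norm (excursion n w))\<^sup>2)"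
proof (rule Bochner_Integration.integrable_bound)
  show "integrable M (\<lambda>w. (\<Sum>i<k. (coef n (Suc i) w)\<^sup>2 * (norm ((S ^^ i) c))\<^sup>2) * k)"
    using coef_sq_integrable[OF assms] by auto
  show "AE w in M. norm ((norm (excursion n w))\<^sup>2)
      \<le> norm ((\<Sum>i<k. (coef n (Suc i) w)\<^sup>2 * (norm ((S ^^ i) c))\<^sup>2) * k)"
  proof (rule AE_I2)
    fix w
    show "norm ((norm (excursion n w))\<^sup>2) \<le> norm ((\<Sum>i<k. (coef n (Suc i) w)\<^sup>2 * (norm ((S ^^ i) c))\<^sup>2) * k)"
      using excursion_sq_le[of n w] by simp
  qed
qed measurable

text \<open>A bound for the expected noise variance in terms of the two parts of the error.\<close>
definition noise_level :: "nat \<Rightarrow> real" where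
  "noise_level n = K0 + 2 * K1 * second_moment (residual n) + 2 * K1 * second_moment (excursion n)"

definition full_step :: "nat \<Rightarrow> 'w \<Rightarrow> 'v" where
  "full_step n w = residual n w - \<eta> n *\<^sub>R slope n w + \<eta> n *\<^sub>R noise (x n w) (\<zeta> n w)"

lemma slope_sq_le: "(norm (slope n w))\<^sup>2 \<le> 2 * (onorm S)\<^sup>2 * (norm (residual n w))\<^sup>2 + 2 * (norm leading)\<^sup>2 * (coef n k w)\<^sup>2"
proof -
  have "(norm (S (residual n w)))\<^sup>2 \<le> (onorm S)\<^sup>2 * (norm (residual n w))\<^sup>2"
    using power_mono[OF onorm[OF bounded_linear_S, of "residual n w"], where n = 2] by (simp add: power_mult_distrib)
  then show ?thesis
    using norm_add_sq_le[of "S (residual n w)" "coef n k w *\<^sub>R leading"]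
    by (simp add: slope_def power_mult_distrib mult_ac)
qed

lemma
  assumes n: "n \<ge> 1" and z: "integrable M (\<lambda>w. (norm (residual n w))\<^sup>2)"
  shows slope_sq_integrable: "integrable M (\<lambda>w. (norm (slope n w))\<^sup>2)"
    and error_sq_integrable: "integrable M (\<lambda>w. (norm (x n w - xstar))\<^sup>2)"
    and noise_level_bound: "K0 + K1 * (LINT w|M. (norm (x n w - xstar))\<^sup>2) \<le> noise_level n"
proof -
  note [measurable] = x_meas[OF n] residual_meas[OF n] slope_meas[OF n]
  note int [simp] = z excursion_sq_integrable[OF n] coef_sq_integrable[OF n]
  show "integrable M (\<lambda>w. (norm (slope n w))\<^sup>2)"
  proof (rule Bochner_Integration.integrable_bound)
    show "integrable M (\<lambda>w. 2 * (onorm S)\<^sup>2 * (norm (residual n w))\<^sup>2 + 2 * (norm leading)\<^sup>2 * (coef n k w)\<^sup>2)"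
      by simp
  qed (use slope_sq_le in \<open>auto intro!: AE_I2\<close>)
  have e: "x n w - xstar = residual n w + excursion n w" for w by (simp add: residual_def)
  show e_int: "integrable M (\<lambda>w. (norm (x n w - xstar))\<^sup>2)"
    unfolding e by (intro integrable_norm_sq_add) auto
  have "(LINT w|M. (norm (x n w - xstar))\<^sup>2) \<le> (LINT w|M. 2 * (norm (residual n w))\<^sup>2 + 2 * (norm (excursion n w))\<^sup>2)"
    using e_int norm_add_sq_le unfolding e by (intro integral_mono) auto
  then have "(LINT w|M. (norm (x n w - xstar))\<^sup>2) \<le> 2 * second_moment (residual n) + 2 * second_moment (excursion n)"
    by simp
  from mult_left_mono[OF this K(2)]
  show "K0 + K1 * (LINT w|M. (norm (x n w - xstar))\<^sup>2) \<le> noise_level n"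
    by (simp add: noise_level_def algebra_simps)
qed

lemma descent_sq_integrable:
  assumes n: "n \<ge> 1" and z: "integrable M (\<lambda>w. (norm (residual n w))\<^sup>2)"
  shows "integrable M (\<lambda>w. (norm (residual n w - \<eta> n *\<^sub>R slope n w))\<^sup>2)"
proof -
  have "integrable M (\<lambda>w. (norm ((- \<eta> n) *\<^sub>R slope n w))\<^sup>2)"
    using slope_sq_integrable[OF n z] by (simp add: power_mult_distrib)
  moreover have "(\<lambda>w. (- \<eta> n) *\<^sub>R slope n w) \<in> borel_measurable M"
    using slope_meas[OF n] by measurable
  ultimately show ?thesis
    using integrable_norm_sq_add[OF residual_meas[OF n] _ z] by fastforce
qed

text \<open>Conditionally on the past the noise is centered, so its variance just adds up. The contraction \<open>T\<close> will be
  the identity for the residual and \<open>P\<close> for its normal part.\<close>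
lemma full_step_second_moment:
  assumes n: "n \<ge> 1" and z: "integrable M (\<lambda>w. (norm (residual n w))\<^sup>2)"
    and T: "linear T" and contr: "\<And>v. norm (T v :: 'v) \<le> norm v"
  shows "integrable M (\<lambda>w. (norm (T (full_step n w)))\<^sup>2)"
    and "second_moment (\<lambda>w. T (full_step n w))
      \<le> second_moment (\<lambda>w. T (residual n w - \<eta> n *\<^sub>R slope n w)) + (\<eta> n)\<^sup>2 * noise_level n"
proof -
  interpret D: prob_space D by (rule D)
  have blT: "bounded_linear T" using T by (simp add: linear_conv_bounded_linear)
  then have [measurable]: "T \<in> borel_measurable borel"
    by (intro borel_measurable_continuous_onI linear_continuous_on)
  define G where "G w = T (residual n w - \<eta> n *\<^sub>R slope n w)" for w
  define N where "N y s = T (\<eta> n *\<^sub>R noise y s)" for y s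
  define V where "V y = (\<eta> n)\<^sup>2 * (K0 + K1 * (norm (y - xstar))\<^sup>2)" for y
  have sum: "T (full_step n w) = G w + N (x n w) (\<zeta> n w)" for w
    unfolding full_step_def G_def N_def by (simp add: linear_add[OF T])
  have GX: "(\<lambda>w. (G w, x n w)) \<in> measurable (hist (past n)) (borel \<Otimes>\<^sub>M borel)"
  proof -
    note [measurable] = x_hist[OF n] residual_hist[OF n] slope_hist[OF n]
    show ?thesis unfolding G_def by measurable
  qed
  note [measurable] = x_meas[OF n] residual_meas[OF n] slope_meas[OF n]
  have Gm: "G \<in> borel_measurable M" unfolding G_def by measurable
  have Nm: "(\<lambda>(y, s). N y s) \<in> borel_measurable (borel \<Otimes>\<^sub>M D)"
    unfolding N_def split_beta' by measurable
  have noise_int: "integrable D (noise y)" for y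
    unfolding noise_def using g_int by simp
  have noise_int': "integrable D (\<lambda>s. \<eta> n *\<^sub>R noise y s)" for y
    using noise_int by simp
  have N_int: "integrable D (N y)" for y
    unfolding N_def using blT noise_int' by (rule integrable_bounded_linear)
  have N_mean: "(LINT s|D. N y s) = 0" for y
  proof -
    have "(LINT s|D. noise y s) = 0"
      unfolding noise_def using g_int by (simp add: g_mean D.prob_space)
    then show ?thesis
      unfolding N_def integral_bounded_linear[OF blT noise_int'] by (simp add: linear_0[OF T])
  qed
  have nsq: "(norm (noise y s))\<^sup>2 = (norm (g y s - (S (y - xstar) + c)))\<^sup>2" for y s
    by (simp add: noise_def norm_minus_commute)
  have N_le: "(norm (N y s))\<^sup>2 \<le> (\<eta> n)\<^sup>2 * (norm (noise y s))\<^sup>2" for y s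
    using power_mono[OF contr[of "\<eta> n *\<^sub>R noise y s"], where n = 2] by (simp add: N_def power_mult_distrib)
  have sq_int: "integrable D (\<lambda>s. (\<eta> n)\<^sup>2 * (norm (noise y s))\<^sup>2)" for y
    using g_sq by (simp add: nsq)
  have N_sq: "integrable D (\<lambda>s. (norm (N y s))\<^sup>2)" for y
    by (rule Bochner_Integration.integrable_bound[OF sq_int[of y]]) (use N_le N_int in auto)
  have N_var: "(LINT s|D. (norm (N y s))\<^sup>2) \<le> V y" for y
  proof -
    have "(LINT s|D. (norm (N y s))\<^sup>2) \<le> (LINT s|D. (\<eta> n)\<^sup>2 * (norm (noise y s))\<^sup>2)"
      using N_sq sq_int N_le by (intro integral_mono) auto
    also have "\<dots> \<le> V y"
      using mult_left_mono[OF g_var, of "(\<eta> n)\<^sup>2" y] by (simp add: nsq V_def)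
    finally show ?thesis .
  qed
  have G_sq: "integrable M (\<lambda>w. (norm (G w))\<^sup>2)"
    unfolding G_def by (rule integrable_norm_sq_linear[OF _ T descent_sq_integrable[OF n z]]) measurable
  have V_int: "integrable M (\<lambda>w. V (x n w))"
    using error_sq_integrable[OF n z] by (simp add: V_def)
  note moments = second_moment_add_centered[OF Gm x_meas[OF n] \<zeta>_meas[OF n] joint_law_sample[OF n GX] D Nm
      N_int N_mean N_sq N_var G_sq V_int]
  show "integrable M (\<lambda>w. (norm (T (full_step n w)))\<^sup>2)"
    unfolding sum by (rule moments(1))
  have "(LINT w|M. V (x n w)) \<le> (\<eta> n)\<^sup>2 * noise_level n"
    using mult_left_mono[OF noise_level_bound[OF n z], of "(\<eta> n)\<^sup>2"] error_sq_integrable[OF n z]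
    by (simp add: V_def prob_space)
  then show "second_moment (\<lambda>w. T (full_step n w))
      \<le> second_moment (\<lambda>w. T (residual n w - \<eta> n *\<^sub>R slope n w)) + (\<eta> n)\<^sup>2 * noise_level n"
    using moments(2) unfolding sum G_def by linarith
qed

lemma residual_Suc_norm_le:
  assumes "n \<ge> 1" "w \<in> space M"
  shows "norm (residual (Suc n) w) \<le> norm (full_step n w)"
  using residual_Suc[OF assms] Q(3) by (simp add: full_step_def)

lemma residual_sq_integrable: "n \<ge> 1 \<Longrightarrow> integrable M (\<lambda>w. (norm (residual n w))\<^sup>2)"
proof (induction n rule: nat_induct_at_least)
  case base
  have "excursion 1 w = 0" for w by (simp add: excursion_def)
  then have "integrable M (\<lambda>w. (norm (residual 1 w))\<^sup>2) \<longleftrightarrow> integrable M (\<lambda>w. (norm (x1 - xstar))\<^sup>2)"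
    using x_init by (intro Bochner_Integration.integrable_cong) (auto simp: residual_def)
  then show ?case by simp
next
  case (Suc n)
  note [measurable] = residual_meas[of "Suc n"]
  have "integrable M (\<lambda>w. (norm (full_step n w))\<^sup>2)"
    using full_step_second_moment(1)[OF Suc.hyps Suc.IH linear_ident] by simp
  then show ?case
    by (rule Bochner_Integration.integrable_bound) (use residual_Suc_norm_le[OF Suc.hyps] in \<open>auto intro!: AE_I2 power_mono\<close>)
qed

lemma gradient_step_norm_sq_le:
  assumes "0 \<le> t"
  shows "(norm (v - t *\<^sub>R S v))\<^sup>2 \<le> (1 - 2 * t * \<mu> + t\<^sup>2 * (onorm S)\<^sup>2) * (norm v)\<^sup>2"
proof -
  have "(norm (v - t *\<^sub>R S v))\<^sup>2 = (norm v)\<^sup>2 - 2 * t * (v \<bullet> S v) + t\<^sup>2 * (norm (S v))\<^sup>2"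
    unfolding power2_norm_eq_inner
    by (simp add: inner_diff_left inner_diff_right inner_commute[of "S v" v] power2_eq_square algebra_simps)
  also have "\<dots> \<le> (norm v)\<^sup>2 - 2 * t * (\<mu> * (norm v)\<^sup>2) + t\<^sup>2 * (onorm S * norm v)\<^sup>2"
    using assms onorm[OF bounded_linear_S, of v]
    by (intro add_mono diff_left_mono mult_left_mono coercive power_mono) auto
  finally show ?thesis by (simp add: algebra_simps power_mult_distrib)
qed

text \<open>The coin does not enter: both \<open>Q\<close> and the identity are contractions. The weight \<open>\<epsilon>\<close> determines which part
  of the contraction \<open>2 \<eta> \<mu>\<close> pays for the cross term with the force \<open>coef n k\<close>.\<close>
lemma residual_second_moment_step:
  assumes n: "n \<ge> 1" and \<epsilon>: "0 < \<epsilon>"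
  shows "second_moment (residual (Suc n)) \<le>
    (1 + \<eta> n * \<epsilon>) * (1 - 2 * \<eta> n * \<mu> + (\<eta> n)\<^sup>2 * (onorm S)\<^sup>2) * second_moment (residual n)
    + (1 + 1 / (\<eta> n * \<epsilon>)) * (\<eta> n)\<^sup>2 * (norm leading)\<^sup>2 * second_moment (coef n k) + (\<eta> n)\<^sup>2 * noise_level n"
proof -
  note [measurable] = residual_meas[OF n] slope_meas[OF n]
  note zi [simp] = residual_sq_integrable[OF n] coef_sq_integrable[OF n]
  have pos: "0 < \<eta> n * \<epsilon>" using \<eta>[OF n] \<epsilon> by simp
  have pointwise: "(norm (residual n w - \<eta> n *\<^sub>R slope n w))\<^sup>2 \<le>
      (1 + \<eta> n * \<epsilon>) * (1 - 2 * \<eta> n * \<mu> + (\<eta> n)\<^sup>2 * (onorm S)\<^sup>2) * (norm (residual n w))\<^sup>2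
      + (1 + 1 / (\<eta> n * \<epsilon>)) * (\<eta> n)\<^sup>2 * (norm leading)\<^sup>2 * (coef n k w)\<^sup>2" for w
  proof -
    have "(norm (residual n w - \<eta> n *\<^sub>R slope n w))\<^sup>2
        = (norm ((residual n w - \<eta> n *\<^sub>R S (residual n w)) - (\<eta> n * coef n k w) *\<^sub>R leading))\<^sup>2"
      by (simp add: slope_def algebra_simps)
    also have "\<dots> \<le> (1 + \<eta> n * \<epsilon>) * (norm (residual n w - \<eta> n *\<^sub>R S (residual n w)))\<^sup>2
        + (1 + 1 / (\<eta> n * \<epsilon>)) * (norm ((\<eta> n * coef n k w) *\<^sub>R leading))\<^sup>2"
      by (rule norm_diff_sq_le_weighted[OF pos])
    also have "(1 + \<eta> n * \<epsilon>) * (norm (residual n w - \<eta> n *\<^sub>R S (residual n w)))\<^sup>2 \<le> (1 + \<eta> n * \<epsilon>) *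
        ((1 - 2 * \<eta> n * \<mu> + (\<eta> n)\<^sup>2 * (onorm S)\<^sup>2) * (norm (residual n w))\<^sup>2)"
      using pos \<eta>[OF n] by (intro mult_left_mono gradient_step_norm_sq_le) auto
    finally show ?thesis by (simp add: power_mult_distrib mult_ac)
  qed
  note gi = descent_sq_integrable[OF n zi(1)]
  note full = full_step_second_moment[OF n zi(1) linear_ident order_refl]
  have "second_moment (residual (Suc n)) \<le> second_moment (full_step n)"
    using full(1) residual_sq_integrable[of "Suc n"] residual_Suc_norm_le[OF n] by (intro integral_mono power_mono) auto
  also have "\<dots> \<le> second_moment (\<lambda>w. residual n w - \<eta> n *\<^sub>R slope n w) + (\<eta> n)\<^sup>2 * noise_level n"
    by (rule full(2))
  also have "second_moment (\<lambda>w. residual n w - \<eta> n *\<^sub>R slope n w) \<le> (LINT w|M.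
      (1 + \<eta> n * \<epsilon>) * (1 - 2 * \<eta> n * \<mu> + (\<eta> n)\<^sup>2 * (onorm S)\<^sup>2) * (norm (residual n w))\<^sup>2
      + (1 + 1 / (\<eta> n * \<epsilon>)) * (\<eta> n)\<^sup>2 * (norm leading)\<^sup>2 * (coef n k w)\<^sup>2)"
    using gi pointwise by (intro integral_mono) auto
  finally show ?thesis by simp
qed

definition P :: "'v \<Rightarrow> 'v" where "P v = v - Q v"

lemma P: "linear P" "norm (P v) \<le> norm v"
  unfolding P_def[abs_def] using Q by (auto intro: linear_compose_sub linear_ident)

text \<open>Here the contraction comes from the coin alone, because \<open>P Q = 0\<close>. The whole slope, including the
  gradient term, counts as a perturbation, and the noise enters with factor \<open>\<eta>\<^sup>2\<close> without division by \<open>p\<close>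
  since it is uncorrelated with the rest.\<close>
lemma normal_second_moment_step:
  assumes n: "n \<ge> 1"
  shows "second_moment (\<lambda>w. P (residual (Suc n) w)) \<le> (1 - p n / 2) * second_moment (\<lambda>w. P (residual n w))
    + 2 / p n * (\<eta> n)\<^sup>2 * (2 * (onorm S)\<^sup>2 * second_moment (residual n) + 2 * (norm leading)\<^sup>2 * second_moment (coef n k))
    + (\<eta> n)\<^sup>2 * noise_level n"
proof -
  have blP: "bounded_linear P" using P(1) by (simp add: linear_conv_bounded_linear)
  then have P_meas [measurable]: "P \<in> borel_measurable borel"
    by (intro borel_measurable_continuous_onI linear_continuous_on)
  have zi: "integrable M (\<lambda>w. (norm (residual n w))\<^sup>2)" by (rule residual_sq_integrable[OF n])
  note full = full_step_second_moment[OF n zi P]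
  have "(\<lambda>w. P (full_step n w)) \<in> borel_measurable (hist (insert (Inl n) (past n)))"
  proof -
    note [measurable] = measurable_hist_mono[OF x_hist[OF n] past_sub(2)]
      measurable_hist_mono[OF residual_hist[OF n] past_sub(2)]
      measurable_hist_mono[OF slope_hist[OF n] past_sub(2)] source_measurable(1)[OF n, OF insertI1]
    show ?thesis unfolding full_step_def by measurable
  qed
  then have "second_moment (\<lambda>w. P (residual (Suc n) w)) = (1 - p n) * second_moment (\<lambda>w. P (full_step n w))"
    by (rule expectation_survives(2)[OF n _ full(1)]) (use n in \<open>auto simp: residual_Suc full_step_def P_def Q(2)\<close>)
  also have "\<dots> \<le> (1 - p n) * (second_moment (\<lambda>w. P (residual n w - \<eta> n *\<^sub>R slope n w)) + (\<eta> n)\<^sup>2 * noise_level n)"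
    using p[OF n] by (intro mult_left_mono full) auto
  finally have 1: "second_moment (\<lambda>w. P (residual (Suc n) w)) \<le>
      (1 - p n) * second_moment (\<lambda>w. P (residual n w - \<eta> n *\<^sub>R slope n w)) + (1 - p n) * ((\<eta> n)\<^sup>2 * noise_level n)"
    by (simp add: algebra_simps)
  note [measurable] = residual_meas[OF n] slope_meas[OF n]
  have [simp]: "integrable M (\<lambda>w. (norm (P (residual n w)))\<^sup>2)"
    by (rule integrable_norm_sq_linear[OF residual_meas[OF n] P(1) zi])
  note pi [simp] = slope_sq_integrable[OF n zi]
  have gi: "integrable M (\<lambda>w. (norm (P (residual n w - \<eta> n *\<^sub>R slope n w)))\<^sup>2)"
    by (rule integrable_norm_sq_linear[OF _ P(1) descent_sq_integrable[OF n zi]]) measurable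
  have pointwise: "(1 - p n) * (norm (P (residual n w - \<eta> n *\<^sub>R slope n w)))\<^sup>2 \<le>
      (1 - p n / 2) * (norm (P (residual n w)))\<^sup>2 + 2 / p n * (\<eta> n)\<^sup>2 * (norm (slope n w))\<^sup>2" for w
  proof -
    have "(norm (P (\<eta> n *\<^sub>R slope n w)))\<^sup>2 \<le> (\<eta> n)\<^sup>2 * (norm (slope n w))\<^sup>2"
      using power_mono[OF P(2)[of "\<eta> n *\<^sub>R slope n w"], where n = 2] by (simp add: power_mult_distrib)
    then have "2 / p n * (norm (P (\<eta> n *\<^sub>R slope n w)))\<^sup>2 \<le> 2 / p n * ((\<eta> n)\<^sup>2 * (norm (slope n w))\<^sup>2)"
      using p[OF n] by (intro mult_left_mono) auto
    then show ?thesis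
      using survival_norm_diff_sq_le[OF p[OF n], of "P (residual n w)" "P (\<eta> n *\<^sub>R slope n w)"]
      by (simp add: linear_diff[OF P(1)] mult_ac)
  qed
  have "(1 - p n) * second_moment (\<lambda>w. P (residual n w - \<eta> n *\<^sub>R slope n w))
      = (LINT w|M. (1 - p n) * (norm (P (residual n w - \<eta> n *\<^sub>R slope n w)))\<^sup>2)" by simp
  also have "\<dots> \<le> (LINT w|M. (1 - p n / 2) * (norm (P (residual n w)))\<^sup>2 + 2 / p n * (\<eta> n)\<^sup>2 * (norm (slope n w))\<^sup>2)"
    using gi pointwise by (intro integral_mono) auto
  also have "\<dots> = (1 - p n / 2) * second_moment (\<lambda>w. P (residual n w)) + 2 / p n * (\<eta> n)\<^sup>2 * second_moment (slope n)"
    by simp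
  finally have 2: "(1 - p n) * second_moment (\<lambda>w. P (residual n w - \<eta> n *\<^sub>R slope n w)) \<le> \<dots>" .
  have "second_moment (slope n) \<le> (LINT w|M. 2 * (onorm S)\<^sup>2 * (norm (residual n w))\<^sup>2 + 2 * (norm leading)\<^sup>2 * (coef n k w)\<^sup>2)"
    using slope_sq_le zi coef_sq_integrable[OF n] by (intro integral_mono) auto
  also have "\<dots> = 2 * (onorm S)\<^sup>2 * second_moment (residual n) + 2 * (norm leading)\<^sup>2 * second_moment (coef n k)"
    using zi coef_sq_integrable[OF n] by simp
  finally have 3: "2 / p n * (\<eta> n)\<^sup>2 * second_moment (slope n) \<le> 2 / p n * (\<eta> n)\<^sup>2 * \<dots>"
    using p[OF n] by (intro mult_left_mono) auto
  have "0 \<le> K0 + K1 * (LINT w|M. (norm (x n w - xstar))\<^sup>2)"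
    using K by (intro add_nonneg_nonneg mult_nonneg_nonneg Bochner_Integration.integral_nonneg) auto
  then have "0 \<le> noise_level n" using noise_level_bound[OF n zi] by simp
  then have 4: "(1 - p n) * ((\<eta> n)\<^sup>2 * noise_level n) \<le> 1 * ((\<eta> n)\<^sup>2 * noise_level n)"
    using p[OF n] by (intro mult_right_mono) auto
  from 1 2 3 4 show ?thesis by linarith
qed

end

section \<open>Rates\<close>

locale projected_sgd_rates = projected_sgd +
  fixes \<eta>0 \<alpha> \<beta> q0 :: real
  assumes \<eta>_eq: "\<And>n. n \<ge> 1 \<Longrightarrow> \<eta> n = \<eta>0 * real n powr (- \<alpha>)"
    and p_ge: "\<And>n. n \<ge> 1 \<Longrightarrow> q0 * real n powr (- (\<alpha> * \<beta>)) \<le> p n"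
    and exponents: "0 < \<alpha>" "\<alpha> \<le> 1" "0 \<le> \<beta>" "\<beta> < 1"
    and pos: "0 < \<eta>0" "0 < q0" "0 < \<mu>"
    and crit: "\<alpha> = 1 \<Longrightarrow> min 1 (2 * real k * (1 - \<beta>)) < \<eta>0 * \<mu>"
begin

lemma \<eta>_bigo: "\<eta> \<in> O(\<lambda>n. real n powr (- \<alpha>))"
proof (rule bigoI[where c = "\<eta>0"])
  show "\<forall>\<^sub>F n in sequentially. norm (\<eta> n) \<le> \<eta>0 * norm (real n powr (- \<alpha>))"
    using eventually_ge_at_top[of 1] by eventually_elim (use pos in \<open>simp add: \<eta>_eq\<close>)
qed

lemma \<eta>_sq_bigo: "(\<lambda>n. (\<eta> n)\<^sup>2) \<in> O(\<lambda>n. real n powr (- 2 * \<alpha>))"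
  unfolding power2_eq_square by (rule bigo_powr_mult[OF \<eta>_bigo \<eta>_bigo]) simp

lemma \<eta>_tendsto_0: "\<eta> \<longlonglongrightarrow> 0"
proof -
  have "(\<lambda>n. \<eta>0 * real n powr (- \<alpha>)) \<longlonglongrightarrow> \<eta>0 * 0"
    using exponents by (intro tendsto_mult tendsto_const tendsto_neg_powr filterlim_real_sequentially) auto
  moreover have "\<forall>\<^sub>F n in sequentially. \<eta>0 * real n powr (- \<alpha>) = \<eta> n"
    using eventually_ge_at_top[of 1] by eventually_elim (simp add: \<eta>_eq)
  ultimately show ?thesis
    using Lim_transform_eventually by fastforce
qed

text \<open>The factor by which an \<open>\<eta>\<close>-sized perturbation enters a second moment that is killed at rate \<open>p\<close>. Relative
  to that rate, of order \<open>n\<close> to the power \<open>- \<alpha> \<beta>\<close>, it gains the square of \<open>\<eta> / p\<close>.\<close>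
lemma gain_bigo:
  "(\<lambda>n. 2 / p n * (\<eta> n)\<^sup>2) \<in> O(\<lambda>n. real n powr (- (\<alpha> * \<beta>) - 2 * \<alpha> * (1 - \<beta>)))"
proof (rule bigo_powr_mult[OF _ \<eta>_sq_bigo])
  show "(\<lambda>n. 2 / p n) \<in> O(\<lambda>n. real n powr (\<alpha> * \<beta>))"
  proof (rule bigoI[where c = "2 / q0"])
    show "\<forall>\<^sub>F n in sequentially. norm (2 / p n) \<le> 2 / q0 * norm (real n powr (\<alpha> * \<beta>))"
      using eventually_ge_at_top[of 1]
    proof eventually_elim
      case (elim n)
      have "2 / p n \<le> 2 / (q0 * real n powr (- (\<alpha> * \<beta>)))"
        using elim pos p_ge[OF elim] p[OF elim] by (intro divide_left_mono mult_pos_pos) auto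
      then show ?case using p[OF elim] by (simp add: powr_minus_divide)
    qed
  qed
  show "\<alpha> * \<beta> + - 2 * \<alpha> \<le> - (\<alpha> * \<beta>) - 2 * \<alpha> * (1 - \<beta>)" by (simp add: algebra_simps)
qed

lemma survival_recursion_bigo:
  fixes X f :: "nat \<Rightarrow> real"
  assumes X: "\<And>n. n \<ge> 1 \<Longrightarrow> 0 \<le> X n"
    and step: "\<And>n. n \<ge> 1 \<Longrightarrow> X (Suc n) \<le> (1 - p n / 2) * X n + f n"
    and f: "f \<in> O(\<lambda>n. real n powr (- (\<alpha> * \<beta> + \<theta>)))" and \<theta>: "0 \<le> \<theta>"
  shows "X \<in> O(\<lambda>n. real n powr (- \<theta>))"
proof (rule contraction_recursion_bigo[where c = "q0 / 2" and a = "\<alpha> * \<beta>"])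
  have ab: "\<alpha> * \<beta> < 1"
    using exponents mult_strict_left_mono[of \<beta> 1 \<alpha>] by linarith
  then show "\<alpha> * \<beta> \<le> 1" "\<alpha> * \<beta> = 1 \<Longrightarrow> \<theta> < q0 / 2" by auto
  show "\<forall>\<^sub>F n in sequentially. q0 / 2 * real n powr (- (\<alpha> * \<beta>)) \<le> 1"
    using eventually_ge_at_top[of 1]
  proof eventually_elim
    case (elim n) then show ?case using p_ge[OF elim] p(2)[OF elim] by simp
  qed
  show "\<forall>\<^sub>F n in sequentially. X (Suc n) \<le> (1 - q0 / 2 * real n powr (- (\<alpha> * \<beta>))) * X n + f n"
    using eventually_ge_at_top[of 1]
  proof eventually_elim
    case (elim n)
    have "(1 - p n / 2) * X n \<le> (1 - q0 / 2 * real n powr (- (\<alpha> * \<beta>))) * X n"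
      using p_ge[OF elim] by (intro mult_right_mono X elim) auto
    then show ?case using step[OF elim] by linarith
  qed
qed (use assms pos in auto)

text \<open>Each link of the chain gains the square of \<open>\<eta> / p\<close> over the preceding one.\<close>
lemma coef_rate:
  "(\<lambda>n. second_moment (coef n j)) \<in> O(\<lambda>n. real n powr (- (2 * real j * \<alpha> * (1 - \<beta>))))"
proof (induction j)
  case 0
  show ?case using const_bigo_1[of 1] by (simp add: prob_space)
next
  case (Suc j)
  show ?case
  proof (rule survival_recursion_bigo)
    show "(\<lambda>n. 2 / p n * (\<eta> n)\<^sup>2 * second_moment (coef n j))
        \<in> O(\<lambda>n. real n powr (- (\<alpha> * \<beta> + 2 * real (Suc j) * \<alpha> * (1 - \<beta>))))"
      by (rule bigo_powr_mult[OF gain_bigo Suc.IH]) (simp add: algebra_simps)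
    show "0 \<le> 2 * real (Suc j) * \<alpha> * (1 - \<beta>)" using exponents by simp
  qed (use coef_sq_step in auto)
qed

lemma excursion_bounded: "(\<lambda>n. second_moment (excursion n)) \<in> O(\<lambda>n. real n powr 0)"
proof (rule bigo_of_nonneg_le)
  show "(\<lambda>n. (\<Sum>i<k. second_moment (coef n (Suc i)) * (norm ((S ^^ i) c))\<^sup>2) * k) \<in> O(\<lambda>n. real n powr 0)"
  proof (rule bigo_powr_mult[OF big_sum_in_bigo const_bigo_1])
    fix i
    show "(\<lambda>n. second_moment (coef n (Suc i)) * (norm ((S ^^ i) c))\<^sup>2) \<in> O(\<lambda>n. real n powr 0)"
      using exponents by (intro bigo_powr_mult[OF bounded_of_bigo_powr[OF coef_rate] const_bigo_1]) auto
  qed simp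
  fix n :: nat assume n: "n \<ge> 1"
  note [simp] = coef_sq_integrable[OF n]
  have "second_moment (excursion n) \<le> (LINT w|M. (\<Sum>i<k. (coef n (Suc i) w)\<^sup>2 * (norm ((S ^^ i) c))\<^sup>2) * k)"
    using excursion_sq_integrable[OF n] excursion_sq_le by (intro integral_mono) auto
  then show "second_moment (excursion n) \<le> (\<Sum>i<k. second_moment (coef n (Suc i)) * (norm ((S ^^ i) c))\<^sup>2) * k"
    by simp
qed simp

text \<open>Relative to the contraction \<open>\<eta> \<mu>\<close>, the forcing is at most of the order of \<open>coef n k\<close> squared plus
  the step size \<open>\<eta>\<close> from the noise.\<close>
lemma residual_rate:
  "(\<lambda>n. second_moment (residual n)) \<in> O(\<lambda>n. real n powr (- (\<alpha> * min 1 (2 * real k * (1 - \<beta>)))))"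
proof (rule contraction_recursion_bigo[where c = "\<eta>0 * \<mu>" and a = \<alpha>])
  let ?\<theta> = "\<alpha> * min 1 (2 * real k * (1 - \<beta>))"
  define f where "f n = ((\<eta> n)\<^sup>2 + 2 / \<mu> * \<eta> n) * ((norm leading)\<^sup>2 * second_moment (coef n k))
    + (\<eta> n)\<^sup>2 * (K0 + 2 * K1 * second_moment (excursion n))" for n
  show "\<alpha> = 1 \<Longrightarrow> ?\<theta> < \<eta>0 * \<mu>" using crit by simp
  show "0 \<le> ?\<theta>" using exponents by simp
  have small: "\<forall>\<^sub>F n in sequentially. \<eta> n * \<mu> < 1"
    using order_tendstoD(2)[OF tendsto_mult_right[OF \<eta>_tendsto_0, of \<mu>], of 1] by simp
  then show "\<forall>\<^sub>F n in sequentially. \<eta>0 * \<mu> * real n powr (- \<alpha>) \<le> 1"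
    using eventually_ge_at_top[of 1] by eventually_elim (simp add: \<eta>_eq mult_ac)
  \<comment> \<open>With weight \<open>\<epsilon> = \<mu> / 2\<close> the contraction factor is \<open>1 - 3/2 \<mu> \<eta>\<close> up to terms of order \<open>\<eta>\<^sup>2\<close>,
    including the part of the noise that is proportional to the residual; half of \<open>\<mu> \<eta>\<close> absorbs them.\<close>
  have "(\<lambda>n. \<eta> n * ((onorm S)\<^sup>2 - \<mu>\<^sup>2 + 2 * K1) + (\<eta> n)\<^sup>2 * (\<mu> * (onorm S)\<^sup>2 / 2))
      \<longlonglongrightarrow> 0 * ((onorm S)\<^sup>2 - \<mu>\<^sup>2 + 2 * K1) + 0\<^sup>2 * (\<mu> * (onorm S)\<^sup>2 / 2)"
    by (intro tendsto_intros \<eta>_tendsto_0)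
  then have "\<forall>\<^sub>F n in sequentially.
      \<eta> n * ((onorm S)\<^sup>2 - \<mu>\<^sup>2 + 2 * K1) + (\<eta> n)\<^sup>2 * (\<mu> * (onorm S)\<^sup>2 / 2) < \<mu> / 2"
    using pos by (intro order_tendstoD) auto
  then show "\<forall>\<^sub>F n in sequentially. second_moment (residual (Suc n)) \<le>
      (1 - \<eta>0 * \<mu> * real n powr (- \<alpha>)) * second_moment (residual n) + f n"
    using eventually_ge_at_top[of 1]
  proof eventually_elim
    case (elim n)
    let ?m = "second_moment (residual n)" and ?e = "\<eta> n" and ?s = "(onorm S)\<^sup>2"
    have e: "0 < ?e" by (rule \<eta>[OF elim(2)])
    have "(1 + ?e * (\<mu> / 2)) * (1 - 2 * ?e * \<mu> + ?e\<^sup>2 * ?s) + 2 * K1 * ?e\<^sup>2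
        = 1 - 3 / 2 * ?e * \<mu> + ?e * (?e * (?s - \<mu>\<^sup>2 + 2 * K1) + ?e\<^sup>2 * (\<mu> * ?s / 2))"
      by (simp add: algebra_simps power2_eq_square)
    also have "\<dots> \<le> 1 - 3 / 2 * ?e * \<mu> + ?e * (\<mu> / 2)"
      using e elim(1) by (intro add_left_mono mult_left_mono) auto
    finally have "((1 + ?e * (\<mu> / 2)) * (1 - 2 * ?e * \<mu> + ?e\<^sup>2 * ?s) + 2 * K1 * ?e\<^sup>2) * ?m \<le> (1 - ?e * \<mu>) * ?m"
      by (intro mult_right_mono) (simp_all add: algebra_simps)
    moreover have "second_moment (residual (Suc n)) \<le>
        ((1 + ?e * (\<mu> / 2)) * (1 - 2 * ?e * \<mu> + ?e\<^sup>2 * ?s) + 2 * K1 * ?e\<^sup>2) * ?m + f n"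
    proof -
      have w: "(1 + 1 / (?e * (\<mu> / 2))) * ?e\<^sup>2 = ?e\<^sup>2 + 2 / \<mu> * ?e"
        using e pos by (simp add: field_simps power2_eq_square)
      show ?thesis
        using residual_second_moment_step[OF elim(2), of "\<mu> / 2"] pos
        unfolding w noise_level_def f_def by (simp add: algebra_simps)
    qed
    ultimately show ?case using elim(2) by (simp add: \<eta>_eq mult_ac)
  qed
  show "f \<in> O(\<lambda>n. real n powr (- (\<alpha> + ?\<theta>)))"
    unfolding f_def
  proof (rule sum_in_bigo)
    have w: "(\<lambda>n. (\<eta> n)\<^sup>2 + 2 / \<mu> * \<eta> n) \<in> O(\<lambda>n. real n powr (- \<alpha>))"
      using exponents pos \<eta>_bigo by (intro sum_in_bigo bigo_powr_mono[OF \<eta>_sq_bigo]) auto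
    have "2 * real k * \<alpha> * (1 - \<beta>) \<ge> ?\<theta>"
      using mult_left_mono[of "min 1 (2 * real k * (1 - \<beta>))" "2 * real k * (1 - \<beta>)" \<alpha>] exponents
      by (simp add: mult_ac)
    moreover have "(\<lambda>n. (norm leading)\<^sup>2 * second_moment (coef n k)) \<in> O(\<lambda>n. real n powr (- (2 * real k * \<alpha> * (1 - \<beta>))))"
      by (rule bigo_powr_mult[OF const_bigo_1 coef_rate]) simp
    ultimately show "(\<lambda>n. ((\<eta> n)\<^sup>2 + 2 / \<mu> * \<eta> n) * ((norm leading)\<^sup>2 * second_moment (coef n k)))
        \<in> O(\<lambda>n. real n powr (- (\<alpha> + ?\<theta>)))"
      by (intro bigo_powr_mult[OF w]) auto
    have "(\<lambda>n. K0 + 2 * K1 * second_moment (excursion n)) \<in> O(\<lambda>n. real n powr 0)"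
      by (intro sum_in_bigo const_bigo_1 bigo_powr_mult[OF const_bigo_1 excursion_bounded]) simp
    note bigo_powr_mult[OF \<eta>_sq_bigo this]
    moreover have "?\<theta> \<le> \<alpha>" using mult_left_mono[of "min 1 (2 * real k * (1 - \<beta>))" 1 \<alpha>] exponents by simp
    ultimately show "(\<lambda>n. (\<eta> n)\<^sup>2 * (K0 + 2 * K1 * second_moment (excursion n))) \<in> O(\<lambda>n. real n powr (- (\<alpha> + ?\<theta>)))"
      by simp
  qed
qed (use pos exponents in auto)

text \<open>Relative to the killing rate \<open>p\<close>, the slope is multiplied by the square of \<open>\<eta> / p\<close> and the noise
  contributes \<open>\<eta>\<^sup>2 / p\<close>, which is of order \<open>n\<close> to the power \<open>- \<alpha> (2 - \<beta>)\<close>.\<close>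
lemma normal_rate:
  "(\<lambda>n. second_moment (\<lambda>w. P (residual n w)))
    \<in> O(\<lambda>n. real n powr (- (\<alpha> * min (2 * real k * (1 - \<beta>)) (2 - \<beta>))))"
proof (rule survival_recursion_bigo)
  let ?a = "min 1 (2 * real k * (1 - \<beta>))" and ?b = "min (2 * real k * (1 - \<beta>)) (2 - \<beta>)"
  let ?f = "\<lambda>n. 2 / p n * (\<eta> n)\<^sup>2 * (2 * (onorm S)\<^sup>2 * second_moment (residual n)
      + 2 * (norm leading)\<^sup>2 * second_moment (coef n k)) + (\<eta> n)\<^sup>2 * noise_level n"
  show "?f \<in> O(\<lambda>n. real n powr (- (\<alpha> * \<beta> + \<alpha> * ?b)))"
  proof (rule sum_in_bigo)
    have k: "\<alpha> * ?a \<le> 2 * real k * \<alpha> * (1 - \<beta>)"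
      using mult_left_mono[of ?a "2 * real k * (1 - \<beta>)" \<alpha>] exponents by (simp add: mult_ac)
    have slope: "(\<lambda>n. 2 * (onorm S)\<^sup>2 * second_moment (residual n) + 2 * (norm leading)\<^sup>2 * second_moment (coef n k))
        \<in> O(\<lambda>n. real n powr (- (\<alpha> * ?a)))"
      using k by (intro sum_in_bigo bigo_powr_mult[OF const_bigo_1 residual_rate] bigo_powr_mult[OF const_bigo_1 coef_rate]) auto
    \<comment> \<open>Either \<open>?a = 2 k (1 - \<beta>)\<close>, which is at least \<open>?b\<close>, or \<open>?a = 1\<close>, and then
      \<open>3 - 2 \<beta> > 2 - \<beta>\<close> because \<open>\<beta> < 1\<close>.\<close>
    have "?b \<le> 2 * (1 - \<beta>) + ?a" using exponents by (auto simp: min_def)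
    from mult_left_mono[OF this, of \<alpha>] exponents
    have "- (\<alpha> * \<beta>) - 2 * \<alpha> * (1 - \<beta>) + - (\<alpha> * ?a) \<le> - (\<alpha> * \<beta> + \<alpha> * ?b)"
      by (simp add: algebra_simps)
    then show "(\<lambda>n. 2 / p n * (\<eta> n)\<^sup>2 * (2 * (onorm S)\<^sup>2 * second_moment (residual n)
        + 2 * (norm leading)\<^sup>2 * second_moment (coef n k))) \<in> O(\<lambda>n. real n powr (- (\<alpha> * \<beta> + \<alpha> * ?b)))"
      by (rule bigo_powr_mult[OF gain_bigo slope])
    have "noise_level \<in> O(\<lambda>n. real n powr 0)"
      unfolding noise_level_def[abs_def] using exponents
      by (intro sum_in_bigo const_bigo_1 bigo_powr_mult[OF const_bigo_1 excursion_bounded]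
          bigo_powr_mult[OF const_bigo_1 bounded_of_bigo_powr[OF residual_rate]]) auto
    note bigo_powr_mult[OF \<eta>_sq_bigo this]
    moreover have "\<alpha> * \<beta> + \<alpha> * ?b \<le> 2 * \<alpha>"
      using mult_left_mono[of ?b "2 - \<beta>" \<alpha>] exponents by (simp add: algebra_simps)
    ultimately show "(\<lambda>n. (\<eta> n)\<^sup>2 * noise_level n) \<in> O(\<lambda>n. real n powr (- (\<alpha> * \<beta> + \<alpha> * ?b)))"
      by simp
  qed
  show "0 \<le> \<alpha> * ?b" using exponents by simp
  show "second_moment (\<lambda>w. P (residual (Suc n) w)) \<le> (1 - p n / 2) * second_moment (\<lambda>w. P (residual n w)) + ?f n" if "n \<ge> 1" for n
    using normal_second_moment_step[OF that] by simp
qed simp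

theorem tangential_rate:
  "n \<ge> 1 \<Longrightarrow> integrable M (\<lambda>w. (norm (Q (x n w) - xstar))\<^sup>2)"
  "(\<lambda>n. second_moment (\<lambda>w. Q (x n w) - xstar)) \<in> O(\<lambda>n. real n powr (- \<alpha> * min 1 (2 * real k * (1 - \<beta>))))"
proof -
  show int: "integrable M (\<lambda>w. (norm (Q (x n w) - xstar))\<^sup>2)" if "n \<ge> 1" for n
    unfolding Q_x by (rule integrable_norm_sq_linear[OF residual_meas[OF that] Q(1) residual_sq_integrable[OF that]])
  show "(\<lambda>n. second_moment (\<lambda>w. Q (x n w) - xstar)) \<in> O(\<lambda>n. real n powr (- \<alpha> * min 1 (2 * real k * (1 - \<beta>))))"
  proof (rule bigo_of_nonneg_le)
    show "second_moment (\<lambda>w. Q (x n w) - xstar) \<le> second_moment (residual n)" if "n \<ge> 1" for n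
      using int[OF that] residual_sq_integrable[OF that] Q(3) unfolding Q_x by (intro integral_mono power_mono) auto
  qed (use residual_rate in simp_all)
qed

theorem normal_gradient_rate:
  assumes k: "k \<ge> 1"
  shows "n \<ge> 1 \<Longrightarrow> integrable M (\<lambda>w. (norm (Q (S (x n w - Q (x n w)))))\<^sup>2)"
    and "(\<lambda>n. second_moment (\<lambda>w. Q (S (x n w - Q (x n w)))))
      \<in> O(\<lambda>n. real n powr (- \<alpha> * min (2 * real k * (1 - \<beta>)) (2 - \<beta>)))"
proof -
  let ?E = "\<lambda>n w. 2 * (onorm S)\<^sup>2 * (norm (P (residual n w)))\<^sup>2 + 2 * (norm leading)\<^sup>2 * (coef n k w)\<^sup>2"
  have le: "(norm (Q (S (x n w - Q (x n w)))))\<^sup>2 \<le> ?E n w" for n w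
  proof -
    have "norm (Q (S (P (residual n w)))) \<le> onorm S * norm (P (residual n w))"
      using order_trans[OF Q(3) onorm[OF bounded_linear_S]] .
    then have "(norm (Q (S (P (residual n w)))))\<^sup>2 \<le> (onorm S * norm (P (residual n w)))\<^sup>2"
      by (intro power_mono) auto
    moreover have "(norm (coef n k w *\<^sub>R Q leading))\<^sup>2 \<le> (\<bar>coef n k w\<bar> * norm leading)\<^sup>2"
      using Q(3) by (intro power_mono) (auto intro: mult_left_mono)
    ultimately show ?thesis
      using norm_add_sq_le[of "Q (S (P (residual n w)))" "coef n k w *\<^sub>R Q leading"]
      unfolding QS_normal_part[OF k] P_def by (simp add: power_mult_distrib mult_ac)
  qed
  have Pz: "integrable M (\<lambda>w. (norm (P (residual n w)))\<^sup>2)" if "n \<ge> 1" for n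
    by (rule integrable_norm_sq_linear[OF residual_meas[OF that] P(1) residual_sq_integrable[OF that]])
  have E: "integrable M (?E n)" if "n \<ge> 1" for n
    using Pz[OF that] coef_sq_integrable[OF that] by simp
  show int: "integrable M (\<lambda>w. (norm (Q (S (x n w - Q (x n w)))))\<^sup>2)" if "n \<ge> 1" for n
  proof (rule Bochner_Integration.integrable_bound[OF E[OF that]])
    note [measurable] = x_meas[OF that]
    show "(\<lambda>w. (norm (Q (S (x n w - Q (x n w)))))\<^sup>2) \<in> borel_measurable M" by measurable
  qed (use le in \<open>auto intro!: AE_I2\<close>)
  show "(\<lambda>n. second_moment (\<lambda>w. Q (S (x n w - Q (x n w)))))
      \<in> O(\<lambda>n. real n powr (- \<alpha> * min (2 * real k * (1 - \<beta>)) (2 - \<beta>)))"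
  proof (rule bigo_of_nonneg_le)
    fix n :: nat assume n: "n \<ge> 1"
    have "second_moment (\<lambda>w. Q (S (x n w - Q (x n w)))) \<le> (LINT w|M. ?E n w)"
      using int[OF n] E[OF n] le by (intro integral_mono) auto
    then show "second_moment (\<lambda>w. Q (S (x n w - Q (x n w)))) \<le>
        2 * (onorm S)\<^sup>2 * second_moment (\<lambda>w. P (residual n w)) + 2 * (norm leading)\<^sup>2 * second_moment (coef n k)"
      using Pz[OF n] coef_sq_integrable[OF n] by simp
  next
    have "\<alpha> * min (2 * real k * (1 - \<beta>)) (2 - \<beta>) \<le> 2 * real k * \<alpha> * (1 - \<beta>)"
      using mult_left_mono[of "min (2 * real k * (1 - \<beta>)) (2 - \<beta>)" "2 * real k * (1 - \<beta>)" \<alpha>] exponents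
      by (simp add: mult_ac)
    then show "(\<lambda>n. 2 * (onorm S)\<^sup>2 * second_moment (\<lambda>w. P (residual n w)) + 2 * (norm leading)\<^sup>2 * second_moment (coef n k))
      \<in> O(\<lambda>n. real n powr (- \<alpha> * min (2 * real k * (1 - \<beta>)) (2 - \<beta>)))"
      by (intro sum_in_bigo bigo_powr_mult[OF const_bigo_1 normal_rate] bigo_powr_mult[OF const_bigo_1 coef_rate]) auto
  qed simp
qed

end

section \<open>Convergence of LPSA\<close>

theorem theorem4p1:
  fixes S :: "real^'d^'d" and b :: "real^'d" and A :: "real^'m^'d"
    and xstar x1 :: "real^'d"
    and g :: "real^'d \<Rightarrow> 'z \<Rightarrow> real^'d"
    and D :: "'z measure" and M :: "'w measure"
    and \<zeta> :: "nat \<Rightarrow> 'w \<Rightarrow> 'z" and \<omega> :: "nat \<Rightarrow> 'w \<Rightarrow> bool"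
    and x x_half \<xi> u v :: "nat \<Rightarrow> 'w \<Rightarrow> real^'d"
    and \<eta> p :: "nat \<Rightarrow> real"
    and L \<eta>0 \<alpha> \<beta> \<gamma> :: real and k :: nat
  assumes S: "sym_pos_def S"
    and minimizer: "is_arg_min (quad_obj S b) (\<lambda>y. transpose A *v y = 0) xstar"
    and order: "1 \<le> k" "has_degenerate_order A S b xstar k"
    and params: "\<gamma> > 0" "0 < \<alpha>" "\<alpha> \<le> 1" "0 \<le> \<beta>" "\<beta> < 1"
    and eta0: "\<eta>0 > 0" "\<eta>0 > 2 * real k * of_bool (\<alpha> = 1) / lambda_min S"
    and \<eta>: "\<And>n. n \<ge> 1 \<Longrightarrow> \<eta> n = \<eta>0 * real n powr (- \<alpha>)"
    and p: "\<And>n. n \<ge> 1 \<Longrightarrow> p n = min (\<gamma> * \<eta> n powr \<beta>) 1"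
    and prob_D: "prob_space D"
    and g_meas: "(\<lambda>(y, z). g y z) \<in> borel_measurable (borel \<Otimes>\<^sub>M D)"
    and g_square_integrable: "\<And>y. integrable D (\<lambda>z. (norm (g y z))\<^sup>2)"
    and g_unbiased: "\<And>y. (LINT z|D. g y z) = quad_grad S b y"
    and cov_lipschitz: "\<And>y y'. spectral_norm (cov_matrix D (g y) - cov_matrix D (g y')) \<le> L * norm (y - y')"
    and prob_M: "prob_space M"
    and \<zeta>_meas: "\<And>n. n \<ge> 1 \<Longrightarrow> \<zeta> n \<in> measurable M D"
    and \<zeta>_distr: "\<And>n. n \<ge> 1 \<Longrightarrow> distr M D (\<zeta> n) = D"
    and \<omega>_meas: "\<And>n. n \<ge> 1 \<Longrightarrow> \<omega> n \<in> measurable M (count_space UNIV)"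
    and \<omega>_distr: "\<And>n. n \<ge> 1 \<Longrightarrow> distr M (count_space UNIV) (\<omega> n) = measure_pmf (bernoulli_pmf (p n))"
    and indep: "samples_coins_independent M D \<zeta> \<omega>"
    and x_init: "\<And>w. w \<in> space M \<Longrightarrow> x 1 w = x1"
    and \<xi>: "\<And>n w. n \<ge> 1 \<Longrightarrow> w \<in> space M \<Longrightarrow> \<xi> n w = quad_grad S b (x n w) - g (x n w) (\<zeta> n w)"
    and x_half: "\<And>n w. n \<ge> 1 \<Longrightarrow> w \<in> space M \<Longrightarrow>
      x_half n w = x n w - \<eta> n *\<^sub>R (S *v x n w - b) + \<eta> n *\<^sub>R \<xi> n w"
    and x_step: "\<And>n w. n \<ge> 1 \<Longrightarrow> w \<in> space M \<Longrightarrow>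
      x (Suc n) w = (if \<omega> n w then proj_perp A (x_half n w) else x_half n w)"
    and u: "\<And>n w. n \<ge> 1 \<Longrightarrow> w \<in> space M \<Longrightarrow> u n w = proj_perp A (x n w)"
    and v: "\<And>n w. n \<ge> 1 \<Longrightarrow> w \<in> space M \<Longrightarrow> v n w = proj_col A (x n w)"
  shows "(\<forall>n\<ge>1. integrable M (\<lambda>w. (norm (u n w - xstar))\<^sup>2)) \<and>
    (\<lambda>n. LINT w|M. (norm (u n w - xstar))\<^sup>2)
      \<in> O(\<lambda>n. real n powr (- \<alpha> * min 1 (2 * real k * (1 - \<beta>)))) \<and>
    (\<forall>n\<ge>1. integrable M (\<lambda>w. (norm (proj_perp A (S *v v n w)))\<^sup>2)) \<and>
    (\<lambda>n. LINT w|M. (norm (proj_perp A (S *v v n w)))\<^sup>2)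
      \<in> O(\<lambda>n. real n powr (- 2 * real k * \<alpha> * (1 - \<beta>)) + real n powr (- \<alpha> * (2 - \<beta>)))"
proof -
  let ?Q = "proj_perp A" and ?S = "\<lambda>y. S *v y" and ?c = "S *v xstar - b"
  let ?K1 = "real CARD('d) * \<bar>L\<bar>" and ?K0 = "(\<Sum>i\<in>UNIV. cov_matrix D (g xstar) $ i $ i) + real CARD('d) * \<bar>L\<bar>"
  let ?q0 = "min (\<gamma> * \<eta>0 powr \<beta>) 1"
  note proj = proj_perp_props[where A = A]
  have g_m: "g y \<in> borel_measurable D" for y
    using measurable_Pair2[OF g_meas, of y] by simp
  note var = variance_eq_trace_cov_matrix[OF prob_D g_m g_square_integrable]
  have mean: "(LINT z|D. g y z) = S *v (y - xstar) + ?c" for y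
    by (simp add: g_unbiased quad_grad_def matrix_vector_mult_diff_distrib)
  \<comment> \<open>The variance is the trace of the covariance matrix, hence Lipschitz in the point; a linear growth
    is weakened to a quadratic one so that it can be absorbed into second moments.\<close>
  have var_bound: "(LINT z|D. (norm (g y z - (S *v (y - xstar) + ?c)))\<^sup>2) \<le> ?K0 + ?K1 * (norm (y - xstar))\<^sup>2" for y
  proof -
    have "(LINT z|D. (norm (g y z - (S *v (y - xstar) + ?c)))\<^sup>2) = (\<Sum>i\<in>UNIV. cov_matrix D (g y) $ i $ i)"
      using var(3)[of y] by (simp only: mean)
    also have "\<dots> = (\<Sum>i\<in>UNIV. cov_matrix D (g xstar) $ i $ i)
        + (\<Sum>i\<in>UNIV. (cov_matrix D (g y) - cov_matrix D (g xstar)) $ i $ i)"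
      by (simp add: sum_subtractf)
    also have "(\<Sum>i\<in>UNIV. (cov_matrix D (g y) - cov_matrix D (g xstar)) $ i $ i) \<le> (\<Sum>i\<in>(UNIV::'d set). L * norm (y - xstar))"
      by (intro sum_mono order_trans[OF diag_entry_le_spectral_norm cov_lipschitz])
    also have "\<dots> = real CARD('d) * (L * norm (y - xstar))" by simp
    also have "\<dots> \<le> real CARD('d) * (\<bar>L\<bar> * (1 + (norm (y - xstar))\<^sup>2))"
    proof -
      have "norm (y - xstar) \<le> 1 + (norm (y - xstar))\<^sup>2"
        using zero_le_power2[of "norm (y - xstar) - 1 / 2"] by (simp add: power2_diff power_divide)
      then show ?thesis by (intro mult_left_mono mult_mono) auto
    qed
    finally show ?thesis by (simp add: algebra_simps)
  qed
  have trace_nonneg: "0 \<le> (\<Sum>i\<in>UNIV. cov_matrix D (g xstar) $ i $ i)"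
    unfolding var(3)[symmetric] by simp
  have feasible: "transpose A *v xstar = 0"
    using minimizer by (simp add: is_arg_min_def)
  have Q_xstar: "?Q xstar = xstar"
    unfolding proj_perp_eq_orth_proj_null_space using feasible
    by (intro orth_proj_eqI)
      (auto simp: subspace_def matrix_vector_right_distrib matrix_vector_mult_scaleR orthogonal_def
        simp del: transpose_matrix_vector)
  have \<eta>_pos: "0 < \<eta> n" if "n \<ge> 1" for n
    using that eta0 by (simp add: \<eta>)
  have q0: "0 < ?q0" using params eta0 by simp
  have p_ge: "?q0 * real n powr (- (\<alpha> * \<beta>)) \<le> p n" if n: "n \<ge> 1" for n
  proof -
    have "\<eta> n powr \<beta> = \<eta>0 powr \<beta> * real n powr (- (\<alpha> * \<beta>))"
      using n by (simp add: \<eta> powr_mult powr_powr)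
    then have pn: "p n = min (\<gamma> * \<eta>0 powr \<beta> * real n powr (- (\<alpha> * \<beta>))) 1"
      using n by (simp add: p mult.assoc)
    have "real n powr (- (\<alpha> * \<beta>)) \<le> real n powr 0"
      using n params by (intro powr_mono) auto
    then have "?q0 * real n powr (- (\<alpha> * \<beta>)) \<le> 1"
      using q0 n by (intro mult_le_one) auto
    moreover have "?q0 * real n powr (- (\<alpha> * \<beta>)) \<le> \<gamma> * \<eta>0 powr \<beta> * real n powr (- (\<alpha> * \<beta>))"
      by (intro mult_right_mono) auto
    ultimately show ?thesis unfolding pn by simp
  qed
  have p_pos: "0 < p n" if "n \<ge> 1" for n
    using p_ge[OF that] q0 that by (smt (verit) mult_pos_pos of_nat_0_less_iff powr_gt_zero not_one_le_zero neq0_conv)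
  \<comment> \<open>For \<open>\<alpha> = 1\<close> the contraction over step \<open>n\<close> is \<open>1 - \<eta>0 \<lambda> / n\<close>, which yields only
    decay exponents below \<open>\<eta>0 \<lambda>\<close>, with \<open>\<lambda>\<close> the least eigenvalue.\<close>
  have crit: "min 1 (2 * real k * (1 - \<beta>)) < \<eta>0 * lambda_min S" if "\<alpha> = 1"
  proof -
    have "2 * real k < \<eta>0 * lambda_min S"
      using eta0(2) lambda_min_rayleigh(1)[OF S] that by (simp add: divide_less_eq)
    moreover have "2 * real k * (1 - \<beta>) \<le> 2 * real k"
      using params by (simp add: mult_left_le)
    ultimately show ?thesis by simp
  qed
  have step: "x (Suc n) w = (if \<omega> n w then ?Q (x n w - \<eta> n *\<^sub>R g (x n w) (\<zeta> n w)) else x n w - \<eta> n *\<^sub>R g (x n w) (\<zeta> n w))"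
    if "n \<ge> 1" "w \<in> space M" for n w
  proof -
    have "x_half n w = x n w - \<eta> n *\<^sub>R g (x n w) (\<zeta> n w)"
      using that by (simp add: x_half \<xi> quad_grad_def algebra_simps)
    then show ?thesis using x_step[OF that] by simp
  qed
  interpret projected_sgd_rates M D g \<zeta> \<omega> x ?S ?Q ?c xstar x1 \<eta> p "lambda_min S" ?K0 ?K1 k \<eta>0 \<alpha> \<beta> ?q0
  proof (intro projected_sgd_rates.intro projected_sgd.intro projected_sgd_axioms.intro projected_sgd_rates_axioms.intro)
    show "linear ?S" by (rule matrix_vector_mul_linear)
    show "lambda_min S * (norm v)\<^sup>2 \<le> v \<bullet> (S *v v)" for v by (rule lambda_min_rayleigh(2)[OF S])
    show "?Q (((*v) S ^^ i) ?c) = 0" if "i < k" for i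
      using order(2) that by (simp add: has_degenerate_order_def)
    show "integrable D (\<lambda>z. (norm (g y z - (S *v (y - xstar) + ?c)))\<^sup>2)" for y
      using var(2)[of y] by (simp only: mean)
    show "p n \<le> 1" if "n \<ge> 1" for n using that by (simp add: p)
    show "0 < lambda_min S" by (rule lambda_min_rayleigh(1)[OF S])
    show "0 \<le> ?K0" using trace_nonneg by simp
  qed (fact prob_M proj Q_xstar prob_D g_meas var(1) mean var_bound \<zeta>_meas \<zeta>_distr \<omega>_meas \<omega>_distr p_pos \<eta>_pos
      indep x_init step \<eta> p_ge params eta0(1) q0 crit | simp)+
  have u_eq: "(norm (u n w - xstar))\<^sup>2 = (norm (?Q (x n w) - xstar))\<^sup>2" if "n \<ge> 1" "w \<in> space M" for n w
    using u[OF that] by simp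
  have v_eq: "(norm (?Q (S *v v n w)))\<^sup>2 = (norm (?Q (S *v (x n w - ?Q (x n w)))))\<^sup>2" if "n \<ge> 1" "w \<in> space M" for n w
    using v[OF that] by (simp add: proj_perp_def)
  let ?r = "\<lambda>n. real n powr (- 2 * real k * \<alpha> * (1 - \<beta>)) + real n powr (- \<alpha> * (2 - \<beta>))"
  have rate: "(\<lambda>n. real n powr (- \<alpha> * min (2 * real k * (1 - \<beta>)) (2 - \<beta>))) \<in> O(?r)"
    by (rule bigoI[where c = 1]) (auto simp: min_def mult_ac)
  show ?thesis
  proof (intro conjI allI impI)
    fix n :: nat assume n: "1 \<le> n"
    show "integrable M (\<lambda>w. (norm (u n w - xstar))\<^sup>2)"
      using tangential_rate(1)[OF n] by (subst Bochner_Integration.integrable_cong[OF refl u_eq[OF n]])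
    show "integrable M (\<lambda>w. (norm (?Q (S *v v n w)))\<^sup>2)"
      using normal_gradient_rate(1)[OF order(1) n] by (subst Bochner_Integration.integrable_cong[OF refl v_eq[OF n]])
  next
    show "(\<lambda>n. LINT w|M. (norm (u n w - xstar))\<^sup>2) \<in> O(\<lambda>n. real n powr (- \<alpha> * min 1 (2 * real k * (1 - \<beta>))))"
      by (rule bigo_of_nonneg_le[OF _ _ tangential_rate(2)])
        (simp_all add: u_eq cong: Bochner_Integration.integral_cong)
    show "(\<lambda>n. LINT w|M. (norm (?Q (S *v v n w)))\<^sup>2) \<in> O(?r)"
      by (rule bigo_of_nonneg_le[OF _ _ landau_o.big_trans[OF normal_gradient_rate(2)[OF order(1)] rate]])
        (simp_all add: v_eq cong: Bochner_Integration.integral_cong)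
  qed
qed

end
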